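(* Let $m\ge 1$, let $a,b,c_1,\dots,c_m\in\mathbb{C}$ be arbitrary, and let $I(m)$ be the left ideal of the Weyl algebra $D=\mathbb{C}\langle x_1,\dots,x_m,\partial_1,\dots,\partial_m\rangle$ generated by the operators $$\ell_i=\theta_i(\theta_i+c_i-1)-x_i(\theta+a)(\theta+b),\qquad i=1,\dots,m,$$ where $\theta_i=x_i\partial_i$ and $\theta=\theta_1+\cdots+\theta_m$. Then the singular locus $\mathrm{Sing}(I(m))\subset\mathbb{C}^m$ is equal to the zero set in $\mathbb{C}^m$ of $$\prod_{i=1}^m x_i\ \prod_{(\varepsilon_1,\dots,\varepsilon_m)\in\{-1,1\}^m}\left(1+\varepsilon_1\sqrt{x_1}+\cdots+\varepsilon_m\sqrt{x_m}\right),$$ which, when expanded, is a polynomial in $x_1,\dots,x_m$.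
   Context: In the Weyl algebra $D$ one has $\partial_i x_i=x_i\partial_i+1$, and all other pairs of generators commute. Every element $p\in D$ is written uniquely in normally ordered form $p=\sum_{(\alpha,\beta)} c_{\alpha\beta}x^\alpha\partial^\beta$. For $p\ne0$, its principal symbol $\mathrm{in}_{(\mathbf 0,\mathbf 1)}(p)\in\mathbb{C}[x_1,\dots,x_m,\xi_1,\dots,\xi_m]$ is the sum of the terms $c_{\alpha\beta}x^\alpha\xi^\beta$ over those $(\alpha,\beta)$ with $c_{\alpha\beta}\neq 0$ and $|\beta|=\beta_1+\cdots+\beta_m$ maximal. For a left ideal $I$ of $D$, the characteristic ideal $\mathrm{in}_{(\mathbf 0,\mathbf 1)}(I)$ is the ideal of $\mathbb{C}[x,\xi]$ generated by the principal symbols of all nonzero elements of $I$. The characteristic variety $\mathrm{Ch}(I)\subset\mathbb{C}^{2m}$ is its zero set. The singular locus $\mathrm{Sing}(I)$ is the image of $\mathrm{Ch}(I)\setminus V(\xi_1,\dots,\xi_m)$ under the projection $(x,\xi)\mapsto x$ to $\mathbb{C}^m$. *)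

theory Defs
  imports
    "HOL-Analysis.Analysis"
    "HOL-Library.Poly_Mapping"
    "HOL-Library.Function_Algebras"
    "HOL-Library.Product_Plus"
begin

type_synonym 'm bimono = "('m \<Rightarrow> nat) \<times> ('m \<Rightarrow> nat)"

text \<open>
  Elements of \<open>\<complex>[x, \<xi>]\<close>: the key \<open>(\<alpha>, \<beta>)\<close> stands for \<open>x\<^sup>\<alpha> \<xi>\<^sup>\<beta>\<close>, and the ring structure
  is the convolution product of \<^theory>\<open>HOL-Library.Poly_Mapping\<close>.
\<close>

type_synonym 'm symb_poly = "'m bimono \<Rightarrow>\<^sub>0 complex"


section \<open>The Weyl algebra\<close>

text \<open>
  The Weyl algebra is realised on normally ordered forms: an element is the finitely supported
  family of the coefficients of the \<open>x\<^sup>\<alpha> \<partial>\<^sup>\<beta>\<close> (key \<open>(\<alpha>, \<beta>)\<close>). The product is the bilinear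
  extension of the Leibniz rule
  \<open>x\<^sup>\<alpha> \<partial>\<^sup>\<beta> \<cdot> x\<^sup>\<gamma> \<partial>\<^sup>\<delta> = (\<Sum>\<kappa>\<le>\<beta>,\<gamma>. (\<Prod>i. \<kappa>\<^sub>i! (\<beta>\<^sub>i choose \<kappa>\<^sub>i) (\<gamma>\<^sub>i choose \<kappa>\<^sub>i)) x\<^bsup>\<alpha>+\<gamma>-\<kappa>\<^esup> \<partial>\<^bsup>\<beta>+\<delta>-\<kappa>\<^esup>)\<close>.
  The ring laws and the commutation relations of the generators are proved below; so is the fact
  that every element is the combination of the products \<open>x\<^sup>\<alpha> \<partial>\<^sup>\<beta>\<close> with these coefficients.
\<close>

definition leib :: "('m::finite \<Rightarrow> nat) \<Rightarrow> ('m \<Rightarrow> nat) \<Rightarrow> ('m \<Rightarrow> nat) \<Rightarrow> nat" where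
  "leib \<beta> \<gamma> \<kappa> = (\<Prod>i\<in>UNIV. fact (\<kappa> i) * (\<beta> i choose \<kappa> i) * (\<gamma> i choose \<kappa> i))"

definition mono_mult :: "'m::finite bimono \<Rightarrow> 'm bimono \<Rightarrow> 'm symb_poly" where
  "mono_mult = (\<lambda>(\<alpha>, \<beta>) (\<gamma>, \<delta>).
     \<Sum>\<kappa>\<in>{\<kappa>. \<kappa> \<le> \<beta> \<and> \<kappa> \<le> \<gamma>}.
       Poly_Mapping.single (\<alpha> + \<gamma> - \<kappa>, \<beta> + \<delta> - \<kappa>) (of_nat (leib \<beta> \<gamma> \<kappa>)))"

definition nf_mult :: "'m::finite symb_poly \<Rightarrow> 'm symb_poly \<Rightarrow> 'm symb_poly" where
  "nf_mult p q = (\<Sum>k\<in>Poly_Mapping.keys p. \<Sum>l\<in>Poly_Mapping.keys q.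
     Poly_Mapping.map ((*) (Poly_Mapping.lookup p k * Poly_Mapping.lookup q l)) (mono_mult k l))"

abbreviation unit_exp :: "'m \<Rightarrow> 'm \<Rightarrow> nat" where
  "unit_exp i \<equiv> (\<lambda>j. if j = i then 1 else 0)"

subsection \<open>Associativity\<close>

lemma finite_box: "finite {\<kappa> :: 'm::finite \<Rightarrow> nat. \<forall>i. \<kappa> i \<le> N i}"
proof -
  have "{\<kappa> :: 'm \<Rightarrow> nat. \<forall>i. \<kappa> i \<le> N i} = PiE UNIV (\<lambda>i. {..N i})"
    by (auto simp: PiE_def Pi_def)
  then show ?thesis by (simp add: finite_PiE)
qed

lemma leib_eq_0: "\<not> (\<kappa> \<le> \<beta> \<and> \<kappa> \<le> \<gamma>) \<Longrightarrow> leib \<beta> \<gamma> \<kappa> = 0"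
  unfolding leib_def le_fun_def by (force simp: not_le)

lemma mono_mult_box:
  assumes "\<beta> \<le> N"
  shows "mono_mult (\<alpha>, \<beta>) (\<gamma>, \<delta>) = (\<Sum>\<kappa>\<in>{\<kappa>. \<forall>i. \<kappa> i \<le> N i}.
       Poly_Mapping.single (\<alpha> + \<gamma> - \<kappa>, \<beta> + \<delta> - \<kappa>) (of_nat (leib \<beta> \<gamma> \<kappa>)))"
  unfolding mono_mult_def prod.case
proof (rule sum.mono_neutral_left)
  show "finite {\<kappa>. \<forall>i. \<kappa> i \<le> N i}" by (rule finite_box)
  show "{\<kappa>. \<kappa> \<le> \<beta> \<and> \<kappa> \<le> \<gamma>} \<subseteq> {\<kappa>. \<forall>i. \<kappa> i \<le> N i}"
    using assms by (auto simp: le_fun_def intro: order_trans)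
qed (auto simp: leib_eq_0)

lemma map_mult_conv: "Poly_Mapping.map ((*) (c::complex)) p = Poly_Mapping.single 0 c * p"
  for p :: "'k::monoid_add \<Rightarrow>\<^sub>0 complex"
proof (rule poly_mapping_eqI)
  fix k
  have "Poly_Mapping.lookup (Poly_Mapping.single 0 c * p) k = c * Poly_Mapping.lookup p k"
    by (simp add: lookup_mult lookup_single when_mult)
  then show "Poly_Mapping.lookup (Poly_Mapping.map ((*) c) p) k = Poly_Mapping.lookup (Poly_Mapping.single 0 c * p) k"
    by (simp add: Poly_Mapping.map.rep_eq when_def)
qed

lemma nf_mult_superset:
  assumes "finite A" "Poly_Mapping.keys p \<subseteq> A" "finite B" "Poly_Mapping.keys q \<subseteq> B"
  shows "nf_mult p q = (\<Sum>k\<in>A. \<Sum>l\<in>B. Poly_Mapping.single 0 (Poly_Mapping.lookup p k * Poly_Mapping.lookup q l) * mono_mult k l)"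
proof -
  have "nf_mult p q = (\<Sum>k\<in>Poly_Mapping.keys p. \<Sum>l\<in>B. Poly_Mapping.single 0 (Poly_Mapping.lookup p k * Poly_Mapping.lookup q l) * mono_mult k l)"
    unfolding nf_mult_def map_mult_conv
    by (intro sum.cong sum.mono_neutral_left) (use assms in \<open>auto simp: in_keys_iff\<close>)
  also have "\<dots> = (\<Sum>k\<in>A. \<Sum>l\<in>B. Poly_Mapping.single 0 (Poly_Mapping.lookup p k * Poly_Mapping.lookup q l) * mono_mult k l)"
    by (intro sum.mono_neutral_left) (use assms in \<open>auto simp: in_keys_iff\<close>)
  finally show ?thesis .
qed

lemma nf_mult_add_left: "nf_mult (p + p') q = nf_mult p q + nf_mult p' q"
proof -
  let ?A = "Poly_Mapping.keys p \<union> Poly_Mapping.keys p'"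
  have k: "Poly_Mapping.keys (p + p') \<subseteq> ?A" by (rule keys_add)
  show ?thesis
    by (simp add: nf_mult_superset[of ?A _ "Poly_Mapping.keys q"] k lookup_add algebra_simps single_add
        sum.distrib)
qed

lemma nf_mult_add_right: "nf_mult q (p + p') = nf_mult q p + nf_mult q p'"
proof -
  let ?A = "Poly_Mapping.keys p \<union> Poly_Mapping.keys p'"
  have k: "Poly_Mapping.keys (p + p') \<subseteq> ?A" by (rule keys_add)
  show ?thesis
    by (simp add: nf_mult_superset[of "Poly_Mapping.keys q" _ ?A] k lookup_add algebra_simps single_add
        sum.distrib)
qed

lemma nf_mult_zero [simp]: "nf_mult 0 q = 0" "nf_mult q 0 = 0"
  by (simp_all add: nf_mult_def)

lemma nf_mult_sum_left: "nf_mult (sum f A) q = (\<Sum>a\<in>A. nf_mult (f a) q)"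
  by (induction A rule: infinite_finite_induct) (simp_all add: nf_mult_add_left)

lemma nf_mult_sum_right: "nf_mult q (sum f A) = (\<Sum>a\<in>A. nf_mult q (f a))"
  by (induction A rule: infinite_finite_induct) (simp_all add: nf_mult_add_right)

lemma nf_mult_single:
  "nf_mult (Poly_Mapping.single k c) (Poly_Mapping.single l d) =
     Poly_Mapping.single 0 (c * d) * mono_mult k l"
  by (subst nf_mult_superset[of "{k}" _ "{l}"]) auto

lemma symb_poly_induct [case_names single add]:
  fixes p :: "'k \<Rightarrow>\<^sub>0 complex"
  assumes "\<And>k c. P (Poly_Mapping.single k c)" "\<And>p q. P p \<Longrightarrow> P q \<Longrightarrow> P (p + q)"
  shows "P p"
proof -
  have s: "P (\<Sum>k\<in>A. Poly_Mapping.single k (Poly_Mapping.lookup p k))" if "finite A" for A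
    using that
  proof induction
    case empty
    show ?case using assms(1)[of undefined 0] by simp
  qed (simp add: assms)
  have "p = (\<Sum>k\<in>Poly_Mapping.keys p. Poly_Mapping.single k (Poly_Mapping.lookup p k))"
    by (rule poly_mapping_eqI) (auto simp: lookup_sum lookup_single when_def in_keys_iff sum.delta)
  with s[of "Poly_Mapping.keys p"] show ?thesis by simp
qed

lemma nf_mult_scale_left:
  "nf_mult (Poly_Mapping.single 0 c * p) q = Poly_Mapping.single 0 c * nf_mult p q"
proof (induction p rule: symb_poly_induct)
  case (single k d)
  show ?case
    by (induction q rule: symb_poly_induct)
      (simp_all add: mult_single nf_mult_single nf_mult_add_right mult.assoc [symmetric] distrib_left)
qed (simp add: nf_mult_add_left distrib_left)

lemma nf_mult_scale_right:
  "nf_mult p (Poly_Mapping.single 0 c * q) = Poly_Mapping.single 0 c * nf_mult p q"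
proof (induction p rule: symb_poly_induct)
  case (single k d)
  show ?case
    by (induction q rule: symb_poly_induct)
      (simp_all add: mult_single nf_mult_single nf_mult_add_right mult.assoc [symmetric] distrib_left
        mult.commute [of d c])
qed (simp add: nf_mult_add_left distrib_left)

lemma mono_mult_x: "mono_mult (\<alpha>, 0) (\<gamma>, \<delta>) = Poly_Mapping.single (\<alpha> + \<gamma>, \<delta>) 1"
proof -
  have "{\<kappa>. \<kappa> \<le> (0 :: 'a \<Rightarrow> nat) \<and> \<kappa> \<le> \<gamma>} = {0}"
    by (auto simp: le_fun_def fun_eq_iff)
  then show ?thesis
    by (simp add: mono_mult_def leib_def)
qed

lemma nf_mult_x:
  "nf_mult (Poly_Mapping.single (\<alpha>, 0) c) q = Poly_Mapping.single (\<alpha>, 0) c * q"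
proof (induction q rule: symb_poly_induct)
  case (single k d)
  obtain \<gamma> \<delta> where k: "k = (\<gamma>, \<delta>)" by (metis surj_pair)
  show ?case
    by (simp only: k nf_mult_single mono_mult_x mult_single add_Pair add_0_left mult_1_right)
qed (simp add: nf_mult_add_right distrib_left)

lemma nf_mult_assoc_x:
  "nf_mult (nf_mult (Poly_Mapping.single (\<alpha>, 0) c) p) q =
   nf_mult (Poly_Mapping.single (\<alpha>, 0) c) (nf_mult p q)"
  unfolding nf_mult_x
proof (induction p rule: symb_poly_induct)
  case (single k d)
  show ?case
  proof (induction q rule: symb_poly_induct)
    case (single l e)
    obtain \<alpha>' \<beta> \<gamma> \<delta> where kl: "k = (\<alpha>', \<beta>)" "l = (\<gamma>, \<delta>)" by (metis surj_pair)
    have *: "mono_mult (\<alpha> + \<alpha>', \<beta>) (\<gamma>, \<delta>) = Poly_Mapping.single (\<alpha>, 0) 1 * mono_mult (\<alpha>', \<beta>) (\<gamma>, \<delta>)"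
      unfolding mono_mult_def prod.case sum_distrib_left
    proof (intro sum.cong refl)
      fix \<kappa> assume "\<kappa> \<in> {\<kappa>. \<kappa> \<le> \<beta> \<and> \<kappa> \<le> \<gamma>}"
      then have "\<kappa> i \<le> \<gamma> i" for i by (auto simp: le_fun_def)
      then have "\<alpha> + \<alpha>' + \<gamma> - \<kappa> = \<alpha> + (\<alpha>' + \<gamma> - \<kappa>)"
        by (auto simp: fun_eq_iff add.assoc intro!: Nat.diff_add_assoc trans_le_add2)
      then show "Poly_Mapping.single (\<alpha> + \<alpha>' + \<gamma> - \<kappa>, \<beta> + \<delta> - \<kappa>) (of_nat (leib \<beta> \<gamma> \<kappa>)) =
        Poly_Mapping.single (\<alpha>, 0) (1::complex) *
          Poly_Mapping.single (\<alpha>' + \<gamma> - \<kappa>, \<beta> + \<delta> - \<kappa>) (of_nat (leib \<beta> \<gamma> \<kappa>))"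
        by (simp add: mult_single)
    qed
    have "nf_mult (Poly_Mapping.single (\<alpha>, 0) c * Poly_Mapping.single k d) (Poly_Mapping.single l e)
      = (Poly_Mapping.single 0 (c * d * e) * Poly_Mapping.single (\<alpha>, 0) 1) * mono_mult (\<alpha>', \<beta>) (\<gamma>, \<delta>)"
      by (simp add: kl mult_single nf_mult_single * flip: mult.assoc)
    also have "\<dots> = (Poly_Mapping.single (\<alpha>, 0) c * Poly_Mapping.single 0 (d * e)) * mono_mult (\<alpha>', \<beta>) (\<gamma>, \<delta>)"
      unfolding mult_single by (simp only: mult_1_right mult.assoc add_0_left add_0_right)
    finally show ?case
      by (simp add: kl nf_mult_single mult.assoc zero_fun_def)
  qed (simp add: nf_mult_add_right distrib_left)
qed (simp add: nf_mult_add_left distrib_left)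

lemma leib_remove:
  "leib \<beta> \<gamma> \<kappa> = fact (\<kappa> i) * (\<beta> i choose \<kappa> i) * (\<gamma> i choose \<kappa> i) *
     (\<Prod>j\<in>UNIV-{i}. fact (\<kappa> j) * (\<beta> j choose \<kappa> j) * (\<gamma> j choose \<kappa> j))"
  unfolding leib_def by (rule prod.remove) auto

lemma leib_Pascal:
  "leib (\<beta> + unit_exp i) \<gamma> \<kappa> = leib \<beta> \<gamma> \<kappa> +
     (if \<kappa> i = 0 then 0 else leib \<beta> \<gamma> (\<kappa> - unit_exp i) * (\<gamma> i - (\<kappa> i - 1)))"
proof (cases "\<kappa> i")
  case 0
  have "(\<Prod>j\<in>UNIV-{i}. fact (\<kappa> j) * ((\<beta> + unit_exp i) j choose \<kappa> j) * (\<gamma> j choose \<kappa> j)) =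
    (\<Prod>j\<in>UNIV-{i}. fact (\<kappa> j) * (\<beta> j choose \<kappa> j) * (\<gamma> j choose \<kappa> j))"
    by (intro prod.cong) auto
  with 0 show ?thesis unfolding leib_remove[where i = i]
    by simp
next
  case (Suc k)
  let ?R = "\<Prod>j\<in>UNIV-{i}. fact (\<kappa> j) * (\<beta> j choose \<kappa> j) * (\<gamma> j choose \<kappa> j)"
  have R: "(\<Prod>j\<in>UNIV-{i}. fact (\<kappa> j) * ((\<beta> + unit_exp i) j choose \<kappa> j) * (\<gamma> j choose \<kappa> j)) = ?R"
    by (intro prod.cong) auto
  have R': "(\<Prod>j\<in>UNIV-{i}. fact ((\<kappa> - unit_exp i) j) * (\<beta> j choose (\<kappa> - unit_exp i) j) *
      (\<gamma> j choose (\<kappa> - unit_exp i) j)) = ?R"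
    by (intro prod.cong) auto
  have ch: "Suc k * (\<gamma> i choose Suc k) = (\<gamma> i - k) * (\<gamma> i choose k)"
    by (metis binomial_absorb_comp binomial_absorption mult.commute)
  have "fact (Suc k) * (Suc (\<beta> i) choose Suc k) * (\<gamma> i choose Suc k) =
     fact (Suc k) * (\<beta> i choose Suc k) * (\<gamma> i choose Suc k) +
     fact k * (\<beta> i choose k) * (Suc k * (\<gamma> i choose Suc k))"
    by (simp add: algebra_simps)
  then have "fact (Suc k) * (Suc (\<beta> i) choose Suc k) * (\<gamma> i choose Suc k) =
     fact (Suc k) * (\<beta> i choose Suc k) * (\<gamma> i choose Suc k) +
     fact k * (\<beta> i choose k) * (\<gamma> i choose k) * (\<gamma> i - k)"
    unfolding ch by (simp add: algebra_simps)
  then show ?thesis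
    unfolding leib_remove[where i = i] R R' using Suc
    by (simp add: algebra_simps del: fact_Suc binomial_Suc_Suc)
qed

lemma mono_mult_d:
  "mono_mult (0, unit_exp i) (\<alpha>, \<beta>) =
     Poly_Mapping.single (\<alpha>, \<beta> + unit_exp i) 1 +
     Poly_Mapping.single (\<alpha> - unit_exp i, \<beta>) (of_nat (\<alpha> i))"
proof -
  have "{\<kappa>. \<forall>j. \<kappa> j \<le> unit_exp i j} = {0, unit_exp i}"
  proof (intro equalityI subsetI)
    fix \<kappa> assume \<kappa>: "\<kappa> \<in> {\<kappa>. \<forall>j. \<kappa> j \<le> unit_exp i j}"
    then have "\<kappa> j = 0" if "j \<noteq> i" for j using that by (auto dest: spec[of _ j])
    moreover from \<kappa> have "\<kappa> i \<le> 1" by (auto dest: spec[of _ i])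
    then have "\<kappa> i = 0 \<or> \<kappa> i = 1" by linarith
    ultimately have "\<kappa> = 0 \<or> \<kappa> = unit_exp i" unfolding fun_eq_iff zero_fun_apply by metis
    then show "\<kappa> \<in> {0, unit_exp i}" by simp
  qed auto
  moreover have "(0 :: 'a \<Rightarrow> nat) \<noteq> unit_exp i" by (auto simp: fun_eq_iff)
  moreover have "leib (unit_exp i) \<alpha> (unit_exp i) = \<alpha> i"
    unfolding leib_remove[where i = i] by simp
  moreover have "leib (unit_exp i) \<alpha> 0 = 1" by (simp add: leib_def)
  ultimately show ?thesis
    by (simp add: mono_mult_box[of _ "unit_exp i"] add.commute)
qed

lemma nf_mult_d_single:
  "nf_mult (Poly_Mapping.single (0, unit_exp i) 1) (Poly_Mapping.single (\<alpha>, \<beta>) c) =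
     Poly_Mapping.single (\<alpha>, \<beta> + unit_exp i) c +
     Poly_Mapping.single (\<alpha> - unit_exp i, \<beta>) (of_nat (\<alpha> i) * c)"
  by (simp add: nf_mult_single mono_mult_d distrib_left mult_single mult.commute)

lemma nf_mult_assoc_d_single:
  fixes i :: "'m::finite"
  shows "nf_mult (nf_mult (Poly_Mapping.single (0, unit_exp i) 1) (Poly_Mapping.single (\<alpha>, \<beta>) 1))
     (Poly_Mapping.single (\<gamma>, \<delta>) 1) =
   nf_mult (Poly_Mapping.single (0, unit_exp i) 1) (mono_mult (\<alpha>, \<beta>) (\<gamma>, \<delta>))"
proof -
  let ?e = "unit_exp i"
  define B where "B = {\<kappa>. \<forall>j. \<kappa> j \<le> (\<beta> + ?e) j}"
  define s where "s \<kappa> c = Poly_Mapping.single (\<alpha> + \<gamma> - \<kappa>, \<beta> + ?e + \<delta> - \<kappa>) (of_nat c :: complex)" for \<kappa> c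
  have finB: "finite B" unfolding B_def by (rule finite_box)
  have s_add: "s \<kappa> (c + d) = s \<kappa> c + s \<kappa> d" for \<kappa> c d by (simp add: s_def single_add)
  have s0 [simp]: "s \<kappa> 0 = 0" for \<kappa> by (simp add: s_def)
  have shift: "Poly_Mapping.single (\<alpha> + \<gamma> - \<kappa> - ?e, \<beta> + \<delta> - \<kappa>) (of_nat c) = s (\<kappa> + ?e) c" for \<kappa> c
  proof -
    have "\<alpha> + \<gamma> - \<kappa> - ?e = \<alpha> + \<gamma> - (\<kappa> + ?e)" "\<beta> + \<delta> - \<kappa> = \<beta> + ?e + \<delta> - (\<kappa> + ?e)"
      by (auto simp: fun_eq_iff)
    then show ?thesis by (simp add: s_def)
  qed
  have rhs: "nf_mult (Poly_Mapping.single (0, ?e) 1) (mono_mult (\<alpha>, \<beta>) (\<gamma>, \<delta>)) =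
    (\<Sum>\<kappa>\<in>B. s \<kappa> (leib \<beta> \<gamma> \<kappa>)) + (\<Sum>\<kappa>\<in>B. s (\<kappa> + ?e) ((\<alpha> i + (\<gamma> i - \<kappa> i)) * leib \<beta> \<gamma> \<kappa>))"
  proof -
    have "\<beta> \<le> \<beta> + ?e" by (simp add: le_fun_def)
    then have "nf_mult (Poly_Mapping.single (0, ?e) 1) (mono_mult (\<alpha>, \<beta>) (\<gamma>, \<delta>)) =
      (\<Sum>\<kappa>\<in>B. Poly_Mapping.single (\<alpha> + \<gamma> - \<kappa>, \<beta> + \<delta> - \<kappa> + ?e) (of_nat (leib \<beta> \<gamma> \<kappa>)) +
         Poly_Mapping.single (\<alpha> + \<gamma> - \<kappa> - ?e, \<beta> + \<delta> - \<kappa>)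
           (of_nat ((\<alpha> + \<gamma> - \<kappa>) i) * of_nat (leib \<beta> \<gamma> \<kappa>)))"
      by (simp add: mono_mult_box B_def nf_mult_sum_right nf_mult_d_single)
    also have "\<dots> = (\<Sum>\<kappa>\<in>B. s \<kappa> (leib \<beta> \<gamma> \<kappa>) + s (\<kappa> + ?e) ((\<alpha> i + (\<gamma> i - \<kappa> i)) * leib \<beta> \<gamma> \<kappa>))"
    proof (intro sum.cong refl)
      fix \<kappa>
      show "Poly_Mapping.single (\<alpha> + \<gamma> - \<kappa>, \<beta> + \<delta> - \<kappa> + ?e) (of_nat (leib \<beta> \<gamma> \<kappa>)) +
         Poly_Mapping.single (\<alpha> + \<gamma> - \<kappa> - ?e, \<beta> + \<delta> - \<kappa>)
           (of_nat ((\<alpha> + \<gamma> - \<kappa>) i) * of_nat (leib \<beta> \<gamma> \<kappa>)) =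
         s \<kappa> (leib \<beta> \<gamma> \<kappa>) + s (\<kappa> + ?e) ((\<alpha> i + (\<gamma> i - \<kappa> i)) * leib \<beta> \<gamma> \<kappa>)"
      proof (cases "\<kappa> \<le> \<beta> \<and> \<kappa> \<le> \<gamma>")
        case False
        then show ?thesis by (simp add: leib_eq_0)
      next
        case True
        then have le: "\<kappa> j \<le> \<beta> j" "\<kappa> j \<le> \<gamma> j" for j by (auto simp: le_fun_def)
        have "\<beta> + \<delta> - \<kappa> + ?e = \<beta> + ?e + \<delta> - \<kappa>"
        proof
          fix j show "(\<beta> + \<delta> - \<kappa> + ?e) j = (\<beta> + ?e + \<delta> - \<kappa>) j" using le(1)[of j] by simp
        qed
        moreover have "(\<alpha> + \<gamma> - \<kappa>) i = \<alpha> i + (\<gamma> i - \<kappa> i)" using le(2)[of i] by simp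
        ultimately show ?thesis
          by (simp only: s_def[of \<kappa>] shift flip: of_nat_mult)
      qed
    qed
    finally show ?thesis by (simp add: sum.distrib)
  qed
  have "nf_mult (nf_mult (Poly_Mapping.single (0, ?e) 1) (Poly_Mapping.single (\<alpha>, \<beta>) 1))
      (Poly_Mapping.single (\<gamma>, \<delta>) 1) =
    mono_mult (\<alpha>, \<beta> + ?e) (\<gamma>, \<delta>) + Poly_Mapping.single 0 (of_nat (\<alpha> i)) * mono_mult (\<alpha> - ?e, \<beta>) (\<gamma>, \<delta>)"
    unfolding nf_mult_d_single unfolding nf_mult_add_left nf_mult_single
    by (simp only: mult_1_right mult_1_left single_one)
  also have "mono_mult (\<alpha>, \<beta> + ?e) (\<gamma>, \<delta>) = (\<Sum>\<kappa>\<in>B. s \<kappa> (leib (\<beta> + ?e) \<gamma> \<kappa>))"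
    by (simp add: mono_mult_box[of _ "\<beta> + ?e"] B_def s_def)
  also have "\<dots> = (\<Sum>\<kappa>\<in>B. s \<kappa> (leib \<beta> \<gamma> \<kappa>)) +
      (\<Sum>\<kappa>\<in>B. s \<kappa> (if \<kappa> i = 0 then 0 else leib \<beta> \<gamma> (\<kappa> - ?e) * (\<gamma> i - (\<kappa> i - 1))))"
    unfolding leib_Pascal s_add sum.distrib ..
  also have "(\<Sum>\<kappa>\<in>B. s \<kappa> (if \<kappa> i = 0 then 0 else leib \<beta> \<gamma> (\<kappa> - ?e) * (\<gamma> i - (\<kappa> i - 1)))) =
      (\<Sum>\<kappa>\<in>B. s (\<kappa> + ?e) ((\<gamma> i - \<kappa> i) * leib \<beta> \<gamma> \<kappa>))"
    (is "sum ?F B = sum ?G B")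
  proof -
    have "sum ?F B = sum ?F {\<kappa>\<in>B. \<kappa> i \<noteq> 0}"
      using finB by (intro sum.mono_neutral_right) auto
    also have "\<dots> = sum ?G {\<kappa>\<in>B. \<kappa> + ?e \<in> B}"
    proof (rule sum.reindex_bij_witness[where i = "\<lambda>\<kappa>. \<kappa> + ?e" and j = "\<lambda>\<kappa>. \<kappa> - ?e"])
      fix \<kappa> assume \<kappa>: "\<kappa> \<in> {\<kappa>\<in>B. \<kappa> i \<noteq> 0}"
      then have pos: "\<kappa> i > 0" by auto
      show undo: "\<kappa> - ?e + ?e = \<kappa>" using pos by (auto simp: fun_eq_iff)
      have "(\<kappa> - ?e) j \<le> \<kappa> j" for j by simp
      with \<kappa> have "\<kappa> - ?e \<in> B" unfolding B_def by (blast intro: order_trans)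
      with \<kappa> show "\<kappa> - ?e \<in> {\<kappa>\<in>B. \<kappa> + ?e \<in> B}" unfolding mem_Collect_eq undo by blast
      show "?G (\<kappa> - ?e) = ?F \<kappa>"
        unfolding undo using pos by (simp add: mult.commute)
    next
      fix \<kappa> assume "\<kappa> \<in> {\<kappa>\<in>B. \<kappa> + ?e \<in> B}"
      then show "\<kappa> + ?e \<in> {\<kappa>\<in>B. \<kappa> i \<noteq> 0}" by auto
      show "\<kappa> + ?e - ?e = \<kappa>" by (auto simp: fun_eq_iff)
    qed
    also have "\<dots> = sum ?G B"
    proof (rule sum.mono_neutral_left)
      show "\<forall>\<kappa>\<in>B - {\<kappa>\<in>B. \<kappa> + ?e \<in> B}. ?G \<kappa> = 0"
      proof
        fix \<kappa> assume "\<kappa> \<in> B - {\<kappa>\<in>B. \<kappa> + ?e \<in> B}"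
        then have "\<kappa> + ?e \<notin> B" by blast
        then have "\<not> \<kappa> \<le> \<beta>" by (auto simp: B_def le_fun_def)
        then show "?G \<kappa> = 0" by (simp add: leib_eq_0)
      qed
    qed (use finB in auto)
    finally show ?thesis .
  qed
  also have "Poly_Mapping.single 0 (of_nat (\<alpha> i)) * mono_mult (\<alpha> - ?e, \<beta>) (\<gamma>, \<delta>) =
      (\<Sum>\<kappa>\<in>B. s (\<kappa> + ?e) (\<alpha> i * leib \<beta> \<gamma> \<kappa>))"
  proof (cases "\<alpha> i = 0")
    case True
    then show ?thesis by simp
  next
    case False
    have "\<beta> \<le> \<beta> + ?e" by (simp add: le_fun_def)
    then have "Poly_Mapping.single 0 (of_nat (\<alpha> i)) * mono_mult (\<alpha> - ?e, \<beta>) (\<gamma>, \<delta>) =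
      (\<Sum>\<kappa>\<in>B. Poly_Mapping.single (\<alpha> - ?e + \<gamma> - \<kappa>, \<beta> + \<delta> - \<kappa>) (of_nat (\<alpha> i * leib \<beta> \<gamma> \<kappa>)))"
      by (simp add: mono_mult_box B_def sum_distrib_left mult_single del: single_of_nat)
    also have "\<dots> = (\<Sum>\<kappa>\<in>B. s (\<kappa> + ?e) (\<alpha> i * leib \<beta> \<gamma> \<kappa>))"
    proof (intro sum.cong refl)
      fix \<kappa>
      have "\<alpha> - ?e + \<gamma> - \<kappa> = \<alpha> + \<gamma> - \<kappa> - ?e" using False by (auto simp: fun_eq_iff)
      then show "Poly_Mapping.single (\<alpha> - ?e + \<gamma> - \<kappa>, \<beta> + \<delta> - \<kappa>) (of_nat (\<alpha> i * leib \<beta> \<gamma> \<kappa>))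
        = s (\<kappa> + ?e) (\<alpha> i * leib \<beta> \<gamma> \<kappa>)"
        by (simp only: shift)
    qed
    finally show ?thesis .
  qed
  finally show ?thesis
    unfolding rhs distrib_right s_add sum.distrib by (simp only: ac_simps)
qed

lemma nf_mult_assoc_d:
  "nf_mult (nf_mult (Poly_Mapping.single (0, unit_exp i) 1) p) q =
   nf_mult (Poly_Mapping.single (0, unit_exp i) 1) (nf_mult p q)"
proof (induction p rule: symb_poly_induct)
  case (single k c)
  show ?case
  proof (induction q rule: symb_poly_induct)
    case (single l d)
    obtain \<alpha> \<beta> \<gamma> \<delta> where kl: "k = (\<alpha>, \<beta>)" "l = (\<gamma>, \<delta>)" by (metis surj_pair)
    have c: "Poly_Mapping.single k c = Poly_Mapping.single 0 c * Poly_Mapping.single (\<alpha>, \<beta>) 1"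
      and d: "Poly_Mapping.single l d = Poly_Mapping.single 0 d * Poly_Mapping.single (\<gamma>, \<delta>) 1"
      by (simp_all add: kl mult_single)
    show ?case
      unfolding c d nf_mult_scale_left nf_mult_scale_right nf_mult_assoc_d_single
      by (simp add: nf_mult_single)
  qed (simp add: nf_mult_add_right)
qed (simp add: nf_mult_add_left nf_mult_add_right)

lemma nf_mult_assoc: "nf_mult (nf_mult p q) r = nf_mult p (nf_mult q r)"
proof (induction p rule: symb_poly_induct)
  case (single k c)
  obtain \<alpha> \<beta> where k: "k = (\<alpha>, \<beta>)" by (metis surj_pair)
  have d: "nf_mult (nf_mult (Poly_Mapping.single (0, \<beta>) 1) q) r =
    nf_mult (Poly_Mapping.single (0, \<beta>) 1) (nf_mult q r)" for \<beta> :: "'a \<Rightarrow> nat" and q r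
  proof (induction "\<Sum>i\<in>UNIV. \<beta> i" arbitrary: \<beta> q r)
    case 0
    then have "\<beta> = 0" by (auto simp: fun_eq_iff)
    then show ?case by (simp only: nf_mult_assoc_x)
  next
    case (Suc n)
    then have "(\<Sum>i\<in>UNIV. \<beta> i) \<noteq> 0" by linarith
    then have "\<exists>i. \<beta> i \<noteq> 0" by (meson sum.neutral)
    then obtain i where i: "\<beta> i > 0" by auto
    let ?e = "unit_exp i"
    have \<beta>: "\<beta> = (\<beta> - ?e) + ?e" using i by (auto simp: fun_eq_iff)
    have "(\<Sum>j\<in>UNIV. \<beta> j) = (\<Sum>j\<in>UNIV. (\<beta> - ?e) j) + 1"
      by (subst \<beta>) (simp add: sum.distrib)
    with Suc(2) have n: "n = (\<Sum>j\<in>UNIV. (\<beta> - ?e) j)" by simp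
    have eq: "Poly_Mapping.single (0, \<beta>) 1 =
      nf_mult (Poly_Mapping.single (0, ?e) 1) (Poly_Mapping.single (0, \<beta> - ?e) (1::complex))"
      unfolding nf_mult_d_single by (simp flip: \<beta>)
    let ?B = "nf_mult (Poly_Mapping.single (0, ?e) 1) (Poly_Mapping.single (0, \<beta> - ?e) (1::complex))"
    have "nf_mult (nf_mult ?B q) r = nf_mult ?B (nf_mult q r)"
      by (simp only: nf_mult_assoc_d Suc(1)[OF n])
    then show ?case by (simp only: eq[symmetric])
  qed
  have eq: "Poly_Mapping.single k c =
      nf_mult (Poly_Mapping.single (\<alpha>, 0) c) (Poly_Mapping.single (0, \<beta>) 1)"
    by (simp add: nf_mult_x mult_single k)
  show ?case unfolding eq nf_mult_assoc_x d ..
qed (simp add: nf_mult_add_left)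

lemma nf_mult_one_left: "nf_mult 1 q = q"
  using nf_mult_x[of 0 1 q] by (simp flip: zero_prod_def)

lemma nf_mult_one_right: "nf_mult q 1 = q"
proof (induction q rule: symb_poly_induct)
  case (single k c)
  obtain \<alpha> \<beta> where k: "k = (\<alpha>, \<beta>)" by (metis surj_pair)
  have "{\<kappa>. \<kappa> \<le> \<beta> \<and> \<kappa> \<le> (0 :: 'a \<Rightarrow> nat)} = {0}"
    by (auto simp: le_fun_def fun_eq_iff)
  then have "mono_mult k 0 = Poly_Mapping.single k 1"
    by (simp add: mono_mult_def leib_def k zero_prod_def)
  then show ?case
    using nf_mult_single[of k c 0 1] by (simp add: mult_single)
qed (simp add: nf_mult_add_left)


subsection \<open>The ring structure\<close>

typedef 'm weyl = "UNIV :: 'm symb_poly set"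
  morphisms normal_form of_normal_form by simp

setup_lifting type_definition_weyl

instantiation weyl :: (finite) ring_1
begin
lift_definition zero_weyl :: "'a weyl" is 0 .
lift_definition one_weyl :: "'a weyl" is 1 .
lift_definition plus_weyl :: "'a weyl \<Rightarrow> 'a weyl \<Rightarrow> 'a weyl" is "(+)" .
lift_definition minus_weyl :: "'a weyl \<Rightarrow> 'a weyl \<Rightarrow> 'a weyl" is "(-)" .
lift_definition uminus_weyl :: "'a weyl \<Rightarrow> 'a weyl" is uminus .
lift_definition times_weyl :: "'a weyl \<Rightarrow> 'a weyl \<Rightarrow> 'a weyl" is nf_mult .
instance
  by standard (transfer; simp add: nf_mult_assoc nf_mult_one_left nf_mult_one_right
      nf_mult_add_left nf_mult_add_right)+
end

definition wmono :: "complex \<Rightarrow> ('m \<Rightarrow> nat) \<Rightarrow> ('m \<Rightarrow> nat) \<Rightarrow> 'm::finite weyl" where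
  "wmono c \<alpha> \<beta> = of_normal_form (Poly_Mapping.single (\<alpha>, \<beta>) c)"

definition wconst :: "complex \<Rightarrow> 'm::finite weyl" where
  "wconst c = wmono c 0 0"

definition wx :: "'m \<Rightarrow> 'm::finite weyl" where
  "wx i = wmono 1 (unit_exp i) 0"

definition wd :: "'m \<Rightarrow> 'm::finite weyl" where
  "wd i = wmono 1 0 (unit_exp i)"

lemma of_normal_form_mult:
  "of_normal_form p * of_normal_form q = of_normal_form (nf_mult p q)"
  by (simp add: times_weyl.abs_eq)

lemma wmono_mult_x: "wmono c \<alpha> 0 * wmono d \<gamma> \<delta> = wmono (c * d) (\<alpha> + \<gamma>) \<delta>"
  unfolding wmono_def of_normal_form_mult nf_mult_x by (simp add: mult_single)

lemma wd_mult_wmono: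
  "wd i * wmono c \<alpha> \<beta> = wmono c \<alpha> (\<beta> + unit_exp i) + wmono (of_nat (\<alpha> i) * c) (\<alpha> - unit_exp i) \<beta>"
  unfolding wd_def wmono_def of_normal_form_mult nf_mult_d_single plus_weyl.abs_eq ..

text \<open>The next two facts show that \<open>wmono c \<alpha> \<beta>\<close> is the product \<open>c x\<^sup>\<alpha> \<partial>\<^sup>\<beta>\<close>.\<close>

lemma wx_mult_wmono: "wx i * wmono c \<alpha> \<beta> = wmono c (\<alpha> + unit_exp i) \<beta>"
  unfolding wx_def wmono_mult_x by (simp add: add.commute)

lemma wd_mult_wmono_0: "wd i * wmono c 0 \<beta> = wmono c 0 (\<beta> + unit_exp i)"
  unfolding wd_mult_wmono by (simp add: wmono_def flip: zero_weyl_def)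

lemma of_normal_form_sum: "of_normal_form (sum f A) = (\<Sum>a\<in>A. of_normal_form (f a))"
  by (induction A rule: infinite_finite_induct)
    (simp_all flip: zero_weyl_def plus_weyl.abs_eq)

lemma weyl_expansion:
  "p = (\<Sum>(\<alpha>, \<beta>)\<in>Poly_Mapping.keys (normal_form p).
          wmono (Poly_Mapping.lookup (normal_form p) (\<alpha>, \<beta>)) \<alpha> \<beta>)"
proof -
  have "normal_form p = (\<Sum>k\<in>Poly_Mapping.keys (normal_form p).
      Poly_Mapping.single k (Poly_Mapping.lookup (normal_form p) k))"
    by (rule poly_mapping_eqI) (auto simp: lookup_sum lookup_single when_def in_keys_iff sum.delta)
  then have "of_normal_form (normal_form p) = (\<Sum>k\<in>Poly_Mapping.keys (normal_form p).
      of_normal_form (Poly_Mapping.single k (Poly_Mapping.lookup (normal_form p) k)))"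
    by (metis of_normal_form_sum)
  then show ?thesis
    by (simp add: normal_form_inverse wmono_def case_prod_beta)
qed

lemma wmono_zero [simp]: "wmono 0 \<alpha> \<beta> = 0"
  by (simp add: wmono_def zero_weyl_def)

lemma wconst_one: "wconst 1 = 1"
  unfolding wconst_def wmono_def one_weyl_def by (simp flip: zero_prod_def)

lemma wx_wx: "wx i * wx j = wx j * wx i"
  by (simp add: wx_def wmono_mult_x add.commute)

lemma wd_wd: "wd i * wd j = wd j * wd i"
proof -
  have "wd i * wd j = wmono 1 0 (unit_exp j + unit_exp i)" for i j :: 'a
    unfolding wd_def[of j] wd_mult_wmono by simp
  then show ?thesis by (simp only: add.commute)
qed

lemma wd_wx: "wd i * wx j = wx j * wd i + (if i = j then 1 else 0)"
proof -
  have "unit_exp j - unit_exp j = (0 :: 'a \<Rightarrow> nat)" by (rule ext) simp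
  then have "wmono (of_nat (unit_exp j i) * 1) (unit_exp j - unit_exp i) 0 = (if i = j then 1 else 0)"
    by (auto simp: simp flip: wconst_def wconst_one)
  moreover have "wx j * wd i = wmono 1 (unit_exp j) (unit_exp i)"
    unfolding wx_def wd_def wmono_mult_x by simp
  ultimately show ?thesis
    unfolding wx_def[of j] wd_mult_wmono by (simp add: wx_def)
qed

lemma wconst_comm: "wconst c * p = p * wconst c"
proof -
  have "nf_mult (Poly_Mapping.single 0 c) q = nf_mult q (Poly_Mapping.single 0 c)" for q :: "'a symb_poly"
    using nf_mult_scale_left[of c 1 q] nf_mult_scale_right[of q c 1]
    by (simp add: nf_mult_one_left nf_mult_one_right)
  then show ?thesis
    unfolding wconst_def wmono_def zero_prod_def[symmetric]
    by (cases p) (simp only: of_normal_form_mult)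
qed


section \<open>Characteristic variety and singular locus\<close>

text \<open>In the commutative ring \<open>\<complex>[x, \<xi>]\<close> these are just the ideals.\<close>

definition left_ideal :: "'r::ring_1 set \<Rightarrow> bool" where
  "left_ideal J \<longleftrightarrow> 0 \<in> J \<and> (\<forall>p\<in>J. \<forall>q\<in>J. p + q \<in> J) \<and> (\<forall>r. \<forall>p\<in>J. r * p \<in> J)"

definition left_ideal_generated :: "'r::ring_1 set \<Rightarrow> 'r set" where
  "left_ideal_generated S = left_ideal hull S"

definition exp_degree :: "('m::finite \<Rightarrow> nat) \<Rightarrow> nat" where
  "exp_degree \<beta> = (\<Sum>i\<in>UNIV. \<beta> i)"

definition weyl_order :: "'m::finite weyl \<Rightarrow> nat" where
  "weyl_order p = Max ((\<lambda>(\<alpha>, \<beta>). exp_degree \<beta>) ` Poly_Mapping.keys (normal_form p))"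

definition principal_symbol :: "'m::finite weyl \<Rightarrow> 'm symb_poly" where
  "principal_symbol p =
     (\<Sum>(\<alpha>, \<beta>)\<in>{(\<alpha>, \<beta>) \<in> Poly_Mapping.keys (normal_form p). exp_degree \<beta> = weyl_order p}.
        Poly_Mapping.single (\<alpha>, \<beta>) (Poly_Mapping.lookup (normal_form p) (\<alpha>, \<beta>)))"

definition char_ideal :: "'m::finite weyl set \<Rightarrow> 'm symb_poly set" where
  "char_ideal I = left_ideal_generated (principal_symbol ` (I - {0}))"

definition symb_eval :: "'m::finite symb_poly \<Rightarrow> (complex ^ 'm) \<times> (complex ^ 'm) \<Rightarrow> complex" where
  "symb_eval f = (\<lambda>(x, \<xi>). \<Sum>(\<alpha>, \<beta>)\<in>Poly_Mapping.keys f.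
     Poly_Mapping.lookup f (\<alpha>, \<beta>) * (\<Prod>i\<in>UNIV. x $ i ^ \<alpha> i) * (\<Prod>i\<in>UNIV. \<xi> $ i ^ \<beta> i))"

definition char_variety :: "'m::finite weyl set \<Rightarrow> ((complex ^ 'm) \<times> (complex ^ 'm)) set" where
  "char_variety I = {z. \<forall>f\<in>char_ideal I. symb_eval f z = 0}"

definition sing_locus :: "'m::finite weyl set \<Rightarrow> (complex ^ 'm) set" where
  "sing_locus I = fst ` (char_variety I - {(x, \<xi>). \<forall>i. \<xi> $ i = 0})"


section \<open>The hypergeometric system and its singular locus\<close>

definition wtheta :: "'m \<Rightarrow> 'm::finite weyl" where
  "wtheta i = wx i * wd i"

definition wtheta_total :: "'m::finite weyl" where
  "wtheta_total = (\<Sum>i\<in>UNIV. wtheta i)"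

definition ell :: "complex \<Rightarrow> complex \<Rightarrow> complex ^ 'm \<Rightarrow> 'm \<Rightarrow> 'm::finite weyl" where
  "ell a b c i = wtheta i * (wtheta i + wconst (c $ i - 1))
     - wx i * (wtheta_total + wconst a) * (wtheta_total + wconst b)"

definition hypergeometric_ideal :: "complex \<Rightarrow> complex \<Rightarrow> complex ^ 'm \<Rightarrow> 'm::finite weyl set" where
  "hypergeometric_ideal a b c = left_ideal_generated (range (ell a b c))"

text \<open>Elements of \<open>\<complex>[x]\<close>: the key \<open>\<alpha>\<close> stands for \<open>x\<^sup>\<alpha>\<close>.\<close>

definition poly_eval :: "(('m::finite \<Rightarrow> nat) \<Rightarrow>\<^sub>0 complex) \<Rightarrow> complex ^ 'm \<Rightarrow> complex" where
  "poly_eval f x = (\<Sum>\<alpha>\<in>Poly_Mapping.keys f. Poly_Mapping.lookup f \<alpha> * (\<Prod>i\<in>UNIV. x $ i ^ \<alpha> i))"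

text \<open>
  The defining product, as a function of \<open>x\<close> and of a choice \<open>r\<close> of square roots
  \<open>r\<^sub>i = \<surd>x\<^sub>i\<close>.
\<close>

definition sing_product :: "complex ^ 'm::finite \<Rightarrow> complex ^ 'm \<Rightarrow> complex" where
  "sing_product x r = (\<Prod>i\<in>UNIV. x $ i) *
     (\<Prod>\<epsilon>\<in>{\<epsilon>. \<forall>i. \<epsilon> i \<in> {-1, 1}}. 1 + (\<Sum>i\<in>UNIV. \<epsilon> i * r $ i))"

lemma finite_signs: "finite {\<epsilon> :: 'm::finite \<Rightarrow> complex. \<forall>i. \<epsilon> i \<in> {-1, 1}}"
proof -
  have "{\<epsilon> :: 'm \<Rightarrow> complex. \<forall>i. \<epsilon> i \<in> {-1, 1}} = PiE UNIV (\<lambda>i. {-1, 1})"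
    by (auto simp: PiE_def Pi_def)
  then show ?thesis by (simp add: finite_PiE)
qed

end

theory Submission
  imports Defs
begin

text \<open>
  Put \<open>y\<^sub>i = x\<^sub>i \<xi>\<^sub>i\<close>, \<open>S = y\<^sub>1 + \<dots> + y\<^sub>m\<close> and \<open>L\<^sub>i = y\<^sub>i\<^sup>2 - x\<^sub>i S\<^sup>2\<close>, the principal symbol of the \<open>i\<close>-th generator.
  A point of the characteristic variety with \<open>\<xi> \<noteq> 0\<close> and all \<open>x\<^sub>i \<noteq> 0\<close> satisfies \<open>L\<^sub>i = 0\<close> for all \<open>i\<close>, which
  forces \<open>S \<noteq> 0\<close>; then the \<open>- y\<^sub>i / S\<close> are square roots of the \<open>x\<^sub>i\<close> with sum \<open>-1\<close>, so one of the factors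
  \<open>1 + \<Sum> \<epsilon>\<^sub>i \<surd>x\<^sub>i\<close> vanishes. This is the easy inclusion.

  For the converse, the symbols of all elements of the ideal have to vanish at suitable points. The
  essential fact is that the generators commute (\<open>ell_commute\<close>). If all syzygies of the \<open>L\<^sub>i\<close> are Koszul
  syzygies, an element \<open>\<Sum> q\<^sub>i D\<^sub>i\<close> of the ideal generated by commuting operators \<open>D\<^sub>i\<close> with symbols \<open>L\<^sub>i\<close> can
  be rewritten, without changing it, until no cancellation of leading terms is left; therefore its symbol
  lies in the ideal of the \<open>L\<^sub>i\<close> (\<open>descent\<close>). The \<open>L\<^sub>i\<close> do form a regular sequence, but instead of proving
  this by dimension theory, the syzygies are computed by elementary means in two regions that suffice.

  Near the origin in \<open>x\<close>-space, \<open>L\<^sub>i\<close> is a perturbation of \<open>y\<^sub>i\<^sup>2\<close> by terms vanishing to higher order, and the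
  \<open>y\<^sub>i\<^sup>2\<close> are coprime monomials. This yields Koszul syzygies up to errors of arbitrarily high
  order (\<open>koszul_ell_symb_at_0\<close>), which is enough to see that all symbols are in the ideal
  generated by the \<open>y\<^sub>i\<close> (\<open>symb_in_theta_ideal\<close>). So all points with \<open>y = 0\<close> are in the
  characteristic variety, and every \<open>x\<close> with a vanishing coordinate is in the singular locus.

  Where \<open>S\<close> and all \<open>x\<^sub>i\<close> are invertible, the equations \<open>x\<^sub>i = (y\<^sub>i\<^sup>2 - L\<^sub>i) / S\<^sup>2\<close> show that the \<open>L\<^sub>i\<close> can replace the
  \<open>x\<^sub>i\<close> as coordinates next to the \<open>y\<^sub>i\<close>. Hence syzygies are Koszul up to powers of \<open>S\<close> and of the \<open>x\<^sub>i\<close>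
  (\<open>division_by_ell_symb\<close>, \<open>koszul_syzygies\<close>), and all common zeros of the \<open>L\<^sub>i\<close> in this region belong to the
  characteristic variety (\<open>char_variety_generic\<close>). The zeros of a factor \<open>1 + \<Sum> \<epsilon>\<^sub>i \<surd>x\<^sub>i\<close> lift
  to such points by taking \<open>y\<^sub>i = \<epsilon>\<^sub>i \<surd>x\<^sub>i\<close>.
\<close>

section \<open>Homogeneous parts of polynomials\<close>

lift_definition part :: "'k set \<Rightarrow> ('k \<Rightarrow>\<^sub>0 complex) \<Rightarrow> ('k \<Rightarrow>\<^sub>0 complex)"
  is "\<lambda>A f k. if k \<in> A then f k else 0"
  by (rule finite_subset) auto

lemma lookup_part [simp]:
  "Poly_Mapping.lookup (part A p) k = (if k \<in> A then Poly_Mapping.lookup p k else 0)"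
  by transfer simp

lemma keys_part [simp]: "Poly_Mapping.keys (part A p) = Poly_Mapping.keys p \<inter> A"
  by (auto simp: in_keys_iff split: if_splits)

lemma part_add: "part A (p + q) = part A p + part A q"
  and part_diff: "part A (p - q) = part A p - part A q"
  and part_zero [simp]: "part A 0 = 0"
  by (rule poly_mapping_eqI; simp add: lookup_add lookup_minus)+

lemma part_sum: "part A (sum f B) = (\<Sum>b\<in>B. part A (f b))"
  by (induction B rule: infinite_finite_induct) (simp_all add: part_add)

lemma part_eq_self: "Poly_Mapping.keys p \<subseteq> A \<Longrightarrow> part A p = p"
  by (rule poly_mapping_eqI) (auto simp: in_keys_iff)

lemma part_eq_0: "Poly_Mapping.keys p \<inter> A = {} \<Longrightarrow> part A p = 0"
  by (rule poly_mapping_eqI) (auto simp: in_keys_iff)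

lemma part_single: "part A (Poly_Mapping.single k c) = (if k \<in> A then Poly_Mapping.single k c else 0)"
  by (rule poly_mapping_eqI) (auto simp: lookup_single when_def)

lemma keys_subset_add:
  "Poly_Mapping.keys p \<subseteq> A \<Longrightarrow> Poly_Mapping.keys q \<subseteq> A \<Longrightarrow> Poly_Mapping.keys (p + q) \<subseteq> A"
  using keys_add[of p q] by blast

lemma keys_subset_diff:
  fixes p q :: "'k \<Rightarrow>\<^sub>0 complex"
  shows "Poly_Mapping.keys p \<subseteq> A \<Longrightarrow> Poly_Mapping.keys q \<subseteq> A \<Longrightarrow> Poly_Mapping.keys (p - q) \<subseteq> A"
  using keys_diff[of p q] by blast

lemma keys_subset_uminus:
  fixes p :: "'k \<Rightarrow>\<^sub>0 complex"
  shows "Poly_Mapping.keys p \<subseteq> A \<Longrightarrow> Poly_Mapping.keys (- p) \<subseteq> A"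
  by (auto simp: in_keys_iff)

lemma keys_subset_sum:
  assumes "\<And>b. b \<in> B \<Longrightarrow> Poly_Mapping.keys (f b) \<subseteq> A"
  shows "Poly_Mapping.keys (sum f B) \<subseteq> A"
  using assms
proof (induction B rule: infinite_finite_induct)
  case (insert x F)
  then show ?case by (simp add: keys_subset_add)
qed simp_all

lemma poly_mapping_expansion:
  "p = (\<Sum>k\<in>Poly_Mapping.keys p. Poly_Mapping.single k (Poly_Mapping.lookup p k))"
  for p :: "'k \<Rightarrow>\<^sub>0 complex"
  by (rule poly_mapping_eqI) (auto simp: lookup_sum lookup_single when_def in_keys_iff sum.delta)

definition weight_le :: "('k \<Rightarrow> int) \<Rightarrow> int \<Rightarrow> ('k \<Rightarrow>\<^sub>0 complex) \<Rightarrow> bool" where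
  "weight_le \<phi> n p \<longleftrightarrow> Poly_Mapping.keys p \<subseteq> {k. \<phi> k \<le> n}"

text \<open>
  The name anticipates the use: for \<open>p\<close> of weight at most \<open>n\<close> this is the leading form of \<open>p\<close>, which
  may be zero.
\<close>

definition top_part :: "('k \<Rightarrow> int) \<Rightarrow> int \<Rightarrow> ('k \<Rightarrow>\<^sub>0 complex) \<Rightarrow> ('k \<Rightarrow>\<^sub>0 complex)" where
  "top_part \<phi> n p = part {k. \<phi> k = n} p"

lemma weight_leI: "(\<And>k. k \<in> Poly_Mapping.keys p \<Longrightarrow> \<phi> k \<le> n) \<Longrightarrow> weight_le \<phi> n p"
  and weight_leD: "weight_le \<phi> n p \<Longrightarrow> k \<in> Poly_Mapping.keys p \<Longrightarrow> \<phi> k \<le> n"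
  by (auto simp: weight_le_def)

lemma weight_le_zero [simp]: "weight_le \<phi> n 0" by (simp add: weight_le_def)
lemma weight_le_add: "weight_le \<phi> n p \<Longrightarrow> weight_le \<phi> n q \<Longrightarrow> weight_le \<phi> n (p + q)"
  unfolding weight_le_def by (rule keys_subset_add)
lemma weight_le_diff: "weight_le \<phi> n p \<Longrightarrow> weight_le \<phi> n q \<Longrightarrow> weight_le \<phi> n (p - q)"
  unfolding weight_le_def by (rule keys_subset_diff)
lemma weight_le_sum: "(\<And>b. b \<in> B \<Longrightarrow> weight_le \<phi> n (f b)) \<Longrightarrow> weight_le \<phi> n (sum f B)"
  unfolding weight_le_def by (rule keys_subset_sum)
lemma weight_le_mono: "weight_le \<phi> m p \<Longrightarrow> m \<le> n \<Longrightarrow> weight_le \<phi> n p"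
  by (auto simp: weight_le_def)
lemma weight_le_single: "\<phi> k \<le> n \<Longrightarrow> weight_le \<phi> n (Poly_Mapping.single k c)"
  by (auto simp: weight_le_def)

lemma top_part_add: "top_part \<phi> n (p + q) = top_part \<phi> n p + top_part \<phi> n q"
  and top_part_diff: "top_part \<phi> n (p - q) = top_part \<phi> n p - top_part \<phi> n q"
  and top_part_zero [simp]: "top_part \<phi> n 0 = 0"
  and top_part_sum: "top_part \<phi> n (sum f B) = (\<Sum>b\<in>B. top_part \<phi> n (f b))"
  by (simp_all add: top_part_def part_add part_diff part_sum)

lemma top_part_eq_0: "weight_le \<phi> m p \<Longrightarrow> m < n \<Longrightarrow> top_part \<phi> n p = 0"
  unfolding top_part_def by (rule part_eq_0) (auto simp: weight_le_def)

lemma weight_le_top_part: "weight_le \<phi> n (top_part \<phi> n p)"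
  by (auto simp: weight_le_def top_part_def)

lemma top_part_idem: "top_part \<phi> n (top_part \<phi> n p) = top_part \<phi> n p"
  unfolding top_part_def by (rule part_eq_self) simp

lemma weight_le_drop_top: "weight_le \<phi> n p \<Longrightarrow> top_part \<phi> n p = 0 \<Longrightarrow> weight_le \<phi> (n - 1) p"
proof (rule weight_leI)
  fix k assume a: "weight_le \<phi> n p" "top_part \<phi> n p = 0" "k \<in> Poly_Mapping.keys p"
  have "\<phi> k \<noteq> n"
  proof
    assume "\<phi> k = n"
    with a(3) have "k \<in> Poly_Mapping.keys (top_part \<phi> n p)" by (simp add: top_part_def)
    with a(2) show False by simp
  qed
  with weight_leD[OF a(1,3)] show "\<phi> k \<le> n - 1" by simp
qed

definition additive_weight :: "('k::monoid_add \<Rightarrow> int) \<Rightarrow> bool" where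
  "additive_weight \<phi> \<longleftrightarrow> (\<forall>k l. \<phi> (k + l) = \<phi> k + \<phi> l)"

lemma weight_le_mult:
  fixes p q :: "'k::comm_monoid_add \<Rightarrow>\<^sub>0 complex"
  assumes "additive_weight \<phi>" "weight_le \<phi> a p" "weight_le \<phi> b q"
  shows "weight_le \<phi> (a + b) (p * q)"
proof (rule weight_leI)
  fix k assume "k \<in> Poly_Mapping.keys (p * q)"
  then obtain u v where "k = u + v" "u \<in> Poly_Mapping.keys p" "v \<in> Poly_Mapping.keys q"
    using keys_mult[of p q] by blast
  with assms show "\<phi> k \<le> a + b"
    by (auto simp: additive_weight_def dest!: weight_leD intro!: add_mono)
qed

text \<open>
  Leading forms are multiplicative because a product in which one factor has lower weight cannot
  reach the top weight. Lowest-weight forms need no separate treatment: they are the leading forms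
  for the negated weight.
\<close>

lemma top_part_mult:
  fixes p q :: "'k::comm_monoid_add \<Rightarrow>\<^sub>0 complex"
  assumes \<phi>: "additive_weight \<phi>" and p: "weight_le \<phi> a p" and q: "weight_le \<phi> b q"
  shows "top_part \<phi> (a + b) (p * q) = top_part \<phi> a p * top_part \<phi> b q"
proof -
  let ?p = "top_part \<phi> a p" and ?q = "top_part \<phi> b q"
  have p': "weight_le \<phi> (a - 1) (p - ?p)" and q': "weight_le \<phi> (b - 1) (q - ?q)"
    by (intro weight_le_drop_top weight_le_diff weight_le_top_part p q; simp add: top_part_diff top_part_idem)+
  have "p * q = ?p * ?q + (?p * (q - ?q) + (p - ?p) * q)" by (simp add: algebra_simps)
  moreover have "weight_le \<phi> (a + (b - 1)) (?p * (q - ?q))" "weight_le \<phi> ((a - 1) + b) ((p - ?p) * q)"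
    by (intro weight_le_mult \<phi> weight_le_top_part p' q q')+
  then have "top_part \<phi> (a + b) (?p * (q - ?q)) = 0" "top_part \<phi> (a + b) ((p - ?p) * q) = 0"
    by (auto intro: top_part_eq_0)
  moreover have "top_part \<phi> (a + b) (?p * ?q) = ?p * ?q"
    unfolding top_part_def[of _ "a + b"]
  proof (rule part_eq_self, rule subsetI)
    fix k assume "k \<in> Poly_Mapping.keys (?p * ?q)"
    then obtain u v where "k = u + v" "u \<in> Poly_Mapping.keys ?p" "v \<in> Poly_Mapping.keys ?q"
      using keys_mult[of ?p ?q] by blast
    then show "k \<in> {k. \<phi> k = a + b}" using \<phi> by (auto simp: top_part_def additive_weight_def)
  qed
  ultimately show ?thesis by (simp add: top_part_add)
qed

text \<open>
  If one factor is homogeneous, taking homogeneous parts commutes with the multiplication, with no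
  bound on the weight of the other factor.
\<close>

lemma top_part_mult_homogeneous:
  fixes p f :: "'k::comm_monoid_add \<Rightarrow>\<^sub>0 complex"
  assumes \<phi>: "additive_weight \<phi>" and f: "top_part \<phi> s f = f"
  shows "top_part \<phi> (a + s) (p * f) = top_part \<phi> a p * f"
proof (induction p rule: symb_poly_induct)
  case (single k c)
  have keys: "Poly_Mapping.keys (Poly_Mapping.single k c * f) \<subseteq> {l. \<phi> l = \<phi> k + s}"
  proof
    fix l assume "l \<in> Poly_Mapping.keys (Poly_Mapping.single k c * f)"
    then obtain v where v: "l = k + v" "v \<in> Poly_Mapping.keys f"
      using keys_mult[of "Poly_Mapping.single k c" f] by (auto split: if_splits)
    then have "v \<in> Poly_Mapping.keys (top_part \<phi> s f)" by (simp only: f)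
    then have "\<phi> v = s" by (simp add: top_part_def)
    then show "l \<in> {l. \<phi> l = \<phi> k + s}" using v \<phi> by (simp add: additive_weight_def)
  qed
  have "top_part \<phi> (a + s) (Poly_Mapping.single k c * f) =
      (if \<phi> k = a then Poly_Mapping.single k c * f else 0)"
  proof (cases "\<phi> k = a")
    case True
    then show ?thesis using keys unfolding top_part_def by (auto intro: part_eq_self)
  next
    case False
    then show ?thesis using keys unfolding top_part_def by (force intro: part_eq_0)
  qed
  then show ?case by (simp add: top_part_def part_single)
qed (simp add: distrib_right top_part_add)

lemma lookup_single_mult:
  fixes p :: "'k::cancel_comm_monoid_add \<Rightarrow>\<^sub>0 complex"
  shows "Poly_Mapping.lookup (Poly_Mapping.single k c * p) (k + l) = c * Poly_Mapping.lookup p l"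
  by (simp add: lookup_mult lookup_single when_mult)

lemma monomial_mult_eq_0:
  fixes p :: "'k::cancel_comm_monoid_add \<Rightarrow>\<^sub>0 complex"
  assumes "Poly_Mapping.single k c * p = 0" "c \<noteq> 0"
  shows "p = 0"
proof (rule poly_mapping_eqI)
  fix l
  show "Poly_Mapping.lookup p l = Poly_Mapping.lookup 0 l"
    using lookup_single_mult[of k c p l] assms by simp
qed

lemma weight_le_attained:
  assumes "p \<noteq> 0"
  obtains n where "weight_le \<phi> n p" "top_part \<phi> n p \<noteq> 0"
proof
  let ?n = "Max (\<phi> ` Poly_Mapping.keys p)"
  show u: "weight_le \<phi> ?n p" by (rule weight_leI) simp
  have "Poly_Mapping.keys p \<noteq> {}" using assms by simp
  then have "?n \<in> \<phi> ` Poly_Mapping.keys p" by (intro Max_in) auto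
  then obtain k where "k \<in> Poly_Mapping.keys p" "\<phi> k = ?n" by auto
  then have "k \<in> Poly_Mapping.keys (top_part \<phi> ?n p)" by (simp add: top_part_def)
  then show "top_part \<phi> ?n p \<noteq> 0" by auto
qed

text \<open>
  The leading form of \<open>f p\<close> is the product of the leading forms. So an element is a non-zero-divisor as soon
  as some weight isolates a leading form that is one, for instance a monomial.
\<close>

lemma nonzero_divisor_top_part:
  fixes f p :: "'k::cancel_comm_monoid_add \<Rightarrow>\<^sub>0 complex"
  assumes \<phi>: "additive_weight \<phi>" and f: "weight_le \<phi> a f"
    and reg: "\<And>q. top_part \<phi> a f * q = 0 \<Longrightarrow> q = 0" and z: "f * p = 0"
  shows "p = 0"
proof (rule ccontr)
  assume "p \<noteq> 0"
  then obtain n where n: "weight_le \<phi> n p" "top_part \<phi> n p \<noteq> 0" by (rule weight_le_attained)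
  have "top_part \<phi> a f * top_part \<phi> n p = 0"
    using top_part_mult[OF \<phi> f n(1)] z by simp
  with reg n(2) show False by blast
qed

section \<open>Koszul syzygies from division\<close>

text \<open>
  In a syzygy over \<open>insert k F\<close> divide every coefficient, up to a power of \<open>h\<close>, by \<open>f\<^sub>k\<close> with a remainder in
  \<open>N\<^sub>k\<close>. The remainders \<open>a\<^sub>i\<close> give an element \<open>\<Sum> a\<^sub>i f\<^sub>i\<close> of \<open>N\<^sub>k\<close> which is also a multiple of \<open>f\<^sub>k\<close>, hence zero. So
  they form a syzygy over \<open>F\<close>, and the quotients give the Koszul relations that involve \<open>f\<^sub>k\<close>.
  Antisymmetric coefficients are written as
  \<open>t\<^sub>i\<^sub>j - t\<^sub>j\<^sub>i\<close>, so that their contraction with commuting elements cancels in any characteristic.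
\<close>

lemma koszul_syzygies:
  fixes f :: "'i \<Rightarrow> 'r::comm_ring_1" and h :: 'r
  assumes N_add: "\<And>k a b. a \<in> N k \<Longrightarrow> b \<in> N k \<Longrightarrow> a + b \<in> N k" and N_0: "\<And>k. 0 \<in> N k"
    and N_mult: "\<And>i k a. i \<noteq> k \<Longrightarrow> a \<in> N k \<Longrightarrow> a * f i \<in> N k"
    and N_f: "\<And>k b. f k * b \<in> N k \<Longrightarrow> b = 0"
    and div: "\<And>k g. \<exists>n0. \<forall>n\<ge>n0. \<exists>a b. a \<in> N k \<and> h ^ n * g = a + f k * b"
    and "finite F" "(\<Sum>i\<in>F. g i * f i) = 0"
  shows "\<exists>n t. \<forall>i\<in>F. h ^ n * g i = (\<Sum>j\<in>F. (t i j - t j i) * f j)"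
  using assms(6,7)
proof (induction F arbitrary: g)
  case empty
  then show ?case by simp
next
  case (insert k F)
  have "\<forall>i. \<exists>n0. \<forall>n\<ge>n0. \<exists>a b. a \<in> N k \<and> h ^ n * g i = a + f k * b"
    using div by blast
  then obtain n0 where n0: "\<And>i n. n0 i \<le> n \<Longrightarrow> \<exists>a b. a \<in> N k \<and> h ^ n * g i = a + f k * b"
    by metis
  define n where "n = (\<Sum>i\<in>F. n0 i)"
  have "\<forall>i\<in>F. \<exists>a b. a \<in> N k \<and> h ^ n * g i = a + f k * b"
  proof
    fix i assume "i \<in> F"
    then have "n0 i \<le> n" unfolding n_def using insert(1) by (intro member_le_sum) auto
    then show "\<exists>a b. a \<in> N k \<and> h ^ n * g i = a + f k * b" by (rule n0)
  qed
  then obtain a b where ab: "\<And>i. i \<in> F \<Longrightarrow> a i \<in> N k" "\<And>i. i \<in> F \<Longrightarrow> h ^ n * g i = a i + f k * b i"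
    by metis
  have sum_N: "(\<Sum>i\<in>F. a i * f i) \<in> N k"
    using insert(1,2) ab(1)
  proof (induction F)
    case empty show ?case by (simp add: N_0)
  next
    case (insert x F) then show ?case by (auto intro!: N_add N_mult)
  qed
  have "0 = h ^ n * (g k * f k + (\<Sum>i\<in>F. g i * f i))"
    using insert.hyps insert.prems by simp
  also have "\<dots> = h ^ n * g k * f k + (\<Sum>i\<in>F. (h ^ n * g i) * f i)"
    by (simp add: algebra_simps sum_distrib_left)
  also have "(\<Sum>i\<in>F. (h ^ n * g i) * f i) = (\<Sum>i\<in>F. a i * f i) + f k * (\<Sum>i\<in>F. b i * f i)"
  proof -
    have "(\<Sum>i\<in>F. (h ^ n * g i) * f i) = (\<Sum>i\<in>F. a i * f i + f k * (b i * f i))"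
      by (intro sum.cong refl) (simp add: ab(2) distrib_right mult.assoc)
    then show ?thesis by (simp only: sum.distrib sum_distrib_left)
  qed
  finally have z: "0 = h ^ n * g k * f k + ((\<Sum>i\<in>F. a i * f i) + f k * (\<Sum>i\<in>F. b i * f i))" .
  have "f k * - (x + y) = s - (x * f k + (s + f k * y))" for x y s
    by (simp add: algebra_simps)
  then have eq: "f k * - (h ^ n * g k + (\<Sum>i\<in>F. b i * f i)) = (\<Sum>i\<in>F. a i * f i)"
    by (metis z diff_0_right)
  with sum_N have "- (h ^ n * g k + (\<Sum>i\<in>F. b i * f i)) = 0" by (metis N_f)
  then have gk: "h ^ n * g k = - (\<Sum>i\<in>F. b i * f i)" by (metis eq_neg_iff_add_eq_0 neg_equal_0_iff_equal)
  with eq have "(\<Sum>i\<in>F. a i * f i) = 0" by simp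
  from insert.IH[OF this] obtain m t
    where t: "\<And>i. i \<in> F \<Longrightarrow> h ^ m * a i = (\<Sum>j\<in>F. (t i j - t j i) * f j)" by blast
  define t' where "t' i j = (if i = k then 0 else if j = k then h ^ m * b i else t i j)" for i j
  have "h ^ (m + n) * g i = (\<Sum>j\<in>insert k F. (t' i j - t' j i) * f j)" if "i \<in> insert k F" for i
  proof (cases "i = k")
    case True
    have "(\<Sum>j\<in>insert k F. (t' k j - t' j k) * f j) = (\<Sum>j\<in>F. - (h ^ m * b j) * f j)"
      using insert(1,2) by (auto simp: t'_def intro!: sum.cong)
    also have "\<dots> = h ^ m * (h ^ n * g k)"
      unfolding gk by (simp add: sum_distrib_left sum_negf mult.assoc)
    finally show ?thesis using True by (simp add: power_add mult.assoc)
  next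
    case False
    with that have i: "i \<in> F" by simp
    have "(\<Sum>j\<in>insert k F. (t' i j - t' j i) * f j) = h ^ m * b i * f k + (\<Sum>j\<in>F. (t' i j - t' j i) * f j)"
      using insert(1,2) False by (simp add: t'_def)
    also have "(\<Sum>j\<in>F. (t' i j - t' j i) * f j) = (\<Sum>j\<in>F. (t i j - t j i) * f j)"
      using insert(1,2) False by (intro sum.cong) (auto simp: t'_def)
    also have "\<dots> = h ^ m * a i" using t[OF i] by simp
    also have "h ^ m * b i * f k + h ^ m * a i = h ^ m * (h ^ n * g i)"
      unfolding ab(2)[OF i] by (simp add: algebra_simps)
    finally show ?thesis by (simp add: power_add mult.assoc)
  qed
  then show ?case by blast
qed

section \<open>Weights on the Weyl algebra\<close>

definition order_wt :: "'m::finite bimono \<Rightarrow> int" where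
  "order_wt k = int (exp_degree (snd k))"

text \<open>
  The negative of the V-filtration degree along the origin. Multiplication in the Weyl algebra preserves
  it because \<open>x\<^sub>i\<close> and \<open>\<partial>\<^sub>i\<close> have opposite weights. A polynomial of bounded order and very negative weight
  vanishes to high order in \<open>x\<close> at \<open>0\<close>.
\<close>

definition V_wt :: "'m::finite bimono \<Rightarrow> int" where
  "V_wt k = int (exp_degree (snd k)) - int (exp_degree (fst k))"

lemma exp_degree_add: "exp_degree (\<alpha> + \<beta>) = exp_degree \<alpha> + exp_degree \<beta>"
  by (simp add: exp_degree_def sum.distrib)

lemma exp_degree_zero [simp]: "exp_degree 0 = 0"
  by (simp add: exp_degree_def)

lemma exp_degree_eq_0: "exp_degree \<alpha> = 0 \<longleftrightarrow> \<alpha> = 0"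
  by (auto simp: exp_degree_def fun_eq_iff)

lemma exp_degree_unit [simp]: "exp_degree (unit_exp i) = 1"
  by (simp add: exp_degree_def)

lemma exp_degree_minus: "\<kappa> \<le> \<alpha> \<Longrightarrow> int (exp_degree (\<alpha> - \<kappa>)) = int (exp_degree \<alpha>) - int (exp_degree \<kappa>)"
  by (auto simp: exp_degree_def le_fun_def of_nat_diff sum_subtractf)

lemma additive_order_wt [simp]: "additive_weight order_wt"
  and additive_V_wt [simp]: "additive_weight V_wt"
  by (simp_all add: additive_weight_def order_wt_def V_wt_def exp_degree_add)

lemma mono_mult_lower:
  "mono_mult (\<alpha>, \<beta>) (\<gamma>, \<delta>) - Poly_Mapping.single ((\<alpha>, \<beta>) + (\<gamma>, \<delta>)) 1 =
     (\<Sum>\<kappa>\<in>{\<kappa>. \<kappa> \<le> \<beta> \<and> \<kappa> \<le> \<gamma>} - {0}.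
       Poly_Mapping.single (\<alpha> + \<gamma> - \<kappa>, \<beta> + \<delta> - \<kappa>) (of_nat (leib \<beta> \<gamma> \<kappa>)))"
proof -
  have "finite {\<kappa>. \<kappa> \<le> \<beta> \<and> \<kappa> \<le> \<gamma>}"
    by (rule finite_subset[OF _ finite_box[of \<beta>]]) (auto simp: le_fun_def)
  then show ?thesis
    unfolding mono_mult_def prod.case
    by (subst sum.remove[of _ 0]) (auto simp: le_fun_def leib_def simp del: single_of_nat)
qed

lemma
  shows weight_le_order_wt_mono_mult:
      "weight_le order_wt (order_wt k + order_wt l - 1) (mono_mult k l - Poly_Mapping.single (k + l) 1)"
    and weight_le_V_wt_mono_mult: "weight_le V_wt (V_wt k + V_wt l) (mono_mult k l)"
proof -
  obtain \<alpha> \<beta> \<gamma> \<delta> where kl: "k = (\<alpha>, \<beta>)" "l = (\<gamma>, \<delta>)" by (metis surj_pair)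
  show "weight_le order_wt (order_wt k + order_wt l - 1) (mono_mult k l - Poly_Mapping.single (k + l) 1)"
    unfolding kl mono_mult_lower
  proof (intro weight_le_sum weight_le_single)
    fix \<kappa> assume \<kappa>: "\<kappa> \<in> {\<kappa>. \<kappa> \<le> \<beta> \<and> \<kappa> \<le> \<gamma>} - {0}"
    then have "\<kappa> \<le> \<beta> + \<delta>" by (auto simp: le_fun_def intro: trans_le_add1)
    moreover from \<kappa> have "exp_degree \<kappa> \<noteq> 0" by (simp add: exp_degree_eq_0)
    ultimately show "order_wt (\<alpha> + \<gamma> - \<kappa>, \<beta> + \<delta> - \<kappa>) \<le> order_wt (\<alpha>, \<beta>) + order_wt (\<gamma>, \<delta>) - 1"
      by (simp add: order_wt_def exp_degree_minus exp_degree_add)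
  qed
  show "weight_le V_wt (V_wt k + V_wt l) (mono_mult k l)"
    unfolding kl mono_mult_def prod.case
  proof (intro weight_le_sum weight_le_single)
    fix \<kappa> assume "\<kappa> \<in> {\<kappa>. \<kappa> \<le> \<beta> \<and> \<kappa> \<le> \<gamma>}"
    then have "\<kappa> \<le> \<beta> + \<delta>" "\<kappa> \<le> \<alpha> + \<gamma>"
      by (auto simp: le_fun_def intro: trans_le_add1 trans_le_add2)
    then show "V_wt (\<alpha> + \<gamma> - \<kappa>, \<beta> + \<delta> - \<kappa>) \<le> V_wt (\<alpha>, \<beta>) + V_wt (\<gamma>, \<delta>)"
      by (simp add: V_wt_def exp_degree_minus exp_degree_add)
  qed
qed

lemma additive_weight_0: "additive_weight \<phi> \<Longrightarrow> \<phi> 0 = 0"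
  unfolding additive_weight_def by (metis add.right_neutral add_cancel_left_right)

lemma weight_le_scale: "additive_weight \<phi> \<Longrightarrow> weight_le \<phi> a p \<Longrightarrow> weight_le \<phi> a (Poly_Mapping.single 0 c * p)"
  for p :: "'k::comm_monoid_add \<Rightarrow>\<^sub>0 complex"
  using weight_le_mult[of \<phi> 0 "Poly_Mapping.single 0 c" a p] by (simp add: weight_le_single additive_weight_0)

lemma mult_expansion:
  fixes p q :: "'k::comm_monoid_add \<Rightarrow>\<^sub>0 complex"
  shows "p * q = (\<Sum>k\<in>Poly_Mapping.keys p. \<Sum>l\<in>Poly_Mapping.keys q.
    Poly_Mapping.single 0 (Poly_Mapping.lookup p k * Poly_Mapping.lookup q l) * Poly_Mapping.single (k + l) 1)"
  by (subst (1) poly_mapping_expansion[of p], subst (1) poly_mapping_expansion[of q])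
    (simp add: sum_product mult_single)

lemma nf_mult_expansion:
  "nf_mult p q = (\<Sum>k\<in>Poly_Mapping.keys p. \<Sum>l\<in>Poly_Mapping.keys q.
    Poly_Mapping.single 0 (Poly_Mapping.lookup p k * Poly_Mapping.lookup q l) * mono_mult k l)"
  by (rule nf_mult_superset) auto

text \<open>
  The noncommutative product agrees with the commutative one up to lower order: every correction term
  of the Leibniz rule contracts at least one derivative.
\<close>

lemma weight_le_order_wt_nf_mult_diff:
  assumes p: "weight_le order_wt a p" and q: "weight_le order_wt b q"
  shows "weight_le order_wt (a + b - 1) (nf_mult p q - p * q)"
proof -
  have "nf_mult p q - p * q = (\<Sum>k\<in>Poly_Mapping.keys p. \<Sum>l\<in>Poly_Mapping.keys q.
    Poly_Mapping.single 0 (Poly_Mapping.lookup p k * Poly_Mapping.lookup q l) *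
      (mono_mult k l - Poly_Mapping.single (k + l) 1))"
    unfolding nf_mult_expansion mult_expansion[of p q] by (simp only: right_diff_distrib sum_subtractf)
  moreover have "weight_le order_wt (a + b - 1) \<dots>"
  proof (intro weight_le_sum weight_le_scale additive_order_wt)
    fix k l assume "k \<in> Poly_Mapping.keys p" "l \<in> Poly_Mapping.keys q"
    with p q have "order_wt k \<le> a" "order_wt l \<le> b" by (auto dest: weight_leD)
    then show "weight_le order_wt (a + b - 1) (mono_mult k l - Poly_Mapping.single (k + l) 1)"
      by (intro weight_le_mono[OF weight_le_order_wt_mono_mult]) simp
  qed
  ultimately show ?thesis by simp
qed

lemma weight_le_order_wt_nf_mult:
  assumes p: "weight_le order_wt a p" and q: "weight_le order_wt b q"
  shows "weight_le order_wt (a + b) (nf_mult p q)"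
  using weight_le_add[OF weight_le_mono[OF weight_le_order_wt_nf_mult_diff[OF p q], of "a + b"]
      weight_le_mult[OF additive_order_wt p q]] by simp

lemma top_part_nf_mult:
  assumes p: "weight_le order_wt a p" and q: "weight_le order_wt b q"
  shows "top_part order_wt (a + b) (nf_mult p q) = top_part order_wt a p * top_part order_wt b q"
proof -
  have "top_part order_wt (a + b) (nf_mult p q - p * q) = 0"
    by (rule top_part_eq_0[OF weight_le_order_wt_nf_mult_diff[OF p q]]) simp
  then show ?thesis by (simp add: top_part_diff top_part_mult[OF additive_order_wt p q])
qed

lemma weight_le_V_wt_nf_mult:
  assumes p: "weight_le V_wt a p" and q: "weight_le V_wt b q"
  shows "weight_le V_wt (a + b) (nf_mult p q)"
  unfolding nf_mult_expansion
proof (intro weight_le_sum weight_le_scale additive_V_wt)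
  fix k l assume "k \<in> Poly_Mapping.keys p" "l \<in> Poly_Mapping.keys q"
  with p q have "V_wt k \<le> a" "V_wt l \<le> b" by (auto dest: weight_leD)
  then show "weight_le V_wt (a + b) (mono_mult k l)"
    by (intro weight_le_mono[OF weight_le_V_wt_mono_mult]) simp
qed

section \<open>Order and symbol of Weyl algebra elements\<close>

definition order_le :: "int \<Rightarrow> 'm::finite weyl \<Rightarrow> bool" where
  "order_le n p \<longleftrightarrow> weight_le order_wt n (normal_form p)"

text \<open>
  The part of order exactly \<open>n\<close>. It is the principal symbol if \<open>n\<close> is the order of \<open>p\<close> and zero if \<open>n\<close>
  is larger, which makes it additive and, for given order bounds, multiplicative.
\<close>

definition symb :: "int \<Rightarrow> 'm::finite weyl \<Rightarrow> 'm symb_poly" where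
  "symb n p = top_part order_wt n (normal_form p)"

lemma normal_form_simps:
  "normal_form 0 = 0" "normal_form (p + q) = normal_form p + normal_form q"
  "normal_form (p - q) = normal_form p - normal_form q" "normal_form (- p) = - normal_form p"
  "normal_form (p * q) = nf_mult (normal_form p) (normal_form q)" "normal_form 1 = 1"
  by (transfer; simp)+

lemma normal_form_sum: "normal_form (sum f A) = (\<Sum>a\<in>A. normal_form (f a))"
  by (induction A rule: infinite_finite_induct) (simp_all add: normal_form_simps)

lemma normal_form_eq_0_iff: "normal_form p = 0 \<longleftrightarrow> p = 0"
  by (metis normal_form_simps(1) normal_form_inject)

lemma order_le_zero [simp]: "order_le n 0" by (simp add: order_le_def normal_form_simps)
lemma order_le_add: "order_le n p \<Longrightarrow> order_le n q \<Longrightarrow> order_le n (p + q)"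
  by (simp add: order_le_def normal_form_simps weight_le_add)
lemma order_le_diff: "order_le n p \<Longrightarrow> order_le n q \<Longrightarrow> order_le n (p - q)"
  by (simp add: order_le_def normal_form_simps weight_le_diff)
lemma order_le_sum: "(\<And>a. a \<in> A \<Longrightarrow> order_le n (f a)) \<Longrightarrow> order_le n (sum f A)"
  by (simp add: order_le_def normal_form_sum weight_le_sum)
lemma order_le_mult: "order_le a p \<Longrightarrow> order_le b q \<Longrightarrow> order_le (a + b) (p * q)"
  by (simp add: order_le_def normal_form_simps weight_le_order_wt_nf_mult)
lemma order_le_mono: "order_le m p \<Longrightarrow> m \<le> n \<Longrightarrow> order_le n p"
  by (simp add: order_le_def weight_le_mono)
lemma order_le_ex: "\<exists>n\<ge>m. order_le n p"
proof -
  let ?S = "insert m (order_wt ` Poly_Mapping.keys (normal_form p))"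
  have "order_le (Max ?S) p" unfolding order_le_def by (rule weight_leI) simp
  moreover have "m \<le> Max ?S" by simp
  ultimately show ?thesis by blast
qed

lemma symb_zero [simp]: "symb n 0 = 0"
  and symb_add: "symb n (p + q) = symb n p + symb n q"
  and symb_diff: "symb n (p - q) = symb n p - symb n q"
  and symb_sum: "symb n (sum f A) = (\<Sum>a\<in>A. symb n (f a))"
  by (simp_all add: symb_def normal_form_simps normal_form_sum top_part_add top_part_diff top_part_sum)
lemma symb_mult: "order_le a p \<Longrightarrow> order_le b q \<Longrightarrow> symb (a + b) (p * q) = symb a p * symb b q"
  by (simp add: symb_def order_le_def normal_form_simps top_part_nf_mult)
lemma symb_eq_0: "order_le m p \<Longrightarrow> m < n \<Longrightarrow> symb n p = 0"
  by (simp add: symb_def order_le_def top_part_eq_0)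
lemma order_le_drop: "order_le n p \<Longrightarrow> symb n p = 0 \<Longrightarrow> order_le (n - 1) p"
  by (simp add: symb_def order_le_def weight_le_drop_top)

lemma
  shows order_le_one: "order_le 0 (1 :: 'm::finite weyl)"
    and symb_one: "symb 0 (1 :: 'm weyl) = 1"
proof -
  have k: "Poly_Mapping.keys (1 :: 'm symb_poly) \<subseteq> {k. order_wt k = 0}"
    by (simp add: order_wt_def)
  show "order_le 0 (1 :: 'm weyl)" "symb 0 (1 :: 'm weyl) = 1"
    using k by (auto simp: order_le_def symb_def weight_le_def top_part_def normal_form_simps part_eq_self)
qed

lemma
  assumes "order_le a p"
  shows order_le_power: "order_le (int n * a) (p ^ n)"
    and symb_power: "symb (int n * a) (p ^ n) = symb a p ^ n"
proof -
  have "order_le (int n * a) (p ^ n) \<and> symb (int n * a) (p ^ n) = symb a p ^ n"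
  proof (induction n)
    case 0 show ?case by (simp add: order_le_one symb_one)
  next
    case (Suc n)
    then show ?case using order_le_mult[OF assms] symb_mult[OF assms] by (simp add: distrib_right)
  qed
  then show "order_le (int n * a) (p ^ n)" "symb (int n * a) (p ^ n) = symb a p ^ n" by auto
qed

section \<open>Symbols of commuting operators whose symbols have only Koszul syzygies\<close>

text \<open>
  Write \<open>p = \<Sum> q\<^sub>i D\<^sub>i\<close>. If the orders of the \<open>q\<^sub>i D\<^sub>i\<close> exceed that of \<open>p\<close>, their top symbols form a
  syzygy of the symbols \<open>L\<^sub>i\<close>. If that syzygy is a Koszul syzygy, subtract from \<open>q\<close> the operator Koszul
  syzygy with the same symbol: since the \<open>D\<^sub>i\<close> commute, it contributes nothing to the sum, and the
  orders of the \<open>q\<^sub>i\<close> drop. Once the orders agree, taking symbols exhibits the symbol of \<open>p\<close> in the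
  ideal of the \<open>L\<^sub>i\<close>.

  Two relaxations are carried along, because the \<open>L\<^sub>i\<close> are only understood on two regions of phase
  space. The set \<open>A\<close> of exponents describes an error term that is considered negligible, and \<open>h\<close>, the
  symbol of an operator \<open>H\<close>, is a function that may be inverted. Each step multiplies \<open>p\<close> by a power
  of \<open>H\<close>.
\<close>

lemma descent:
  fixes D :: "'i::finite \<Rightarrow> 'm::finite weyl" and L :: "'i \<Rightarrow> 'm symb_poly"
  assumes comm: "\<And>i j. D i * D j = D j * D i"
    and ord: "\<And>i. order_le s (D i)" and sym: "\<And>i. symb s (D i) = L i"
    and H: "order_le k H" "symb k H = h"
    and A_right: "\<And>r i. Poly_Mapping.keys (normal_form r) \<subseteq> A \<Longrightarrow> Poly_Mapping.keys (normal_form (r * D i)) \<subseteq> A"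
    and A_left: "\<And>r. Poly_Mapping.keys (normal_form r) \<subseteq> A \<Longrightarrow> Poly_Mapping.keys (normal_form (H * r)) \<subseteq> A"
    and syz: "\<And>g. Poly_Mapping.keys (\<Sum>i\<in>UNIV. g i * L i) \<subseteq> A \<Longrightarrow>
       \<exists>n t. \<forall>i. Poly_Mapping.keys (h ^ n * g i - (\<Sum>j\<in>UNIV. (t i j - t j i) * L j)) \<subseteq> A"
    and p: "p = (\<Sum>i\<in>UNIV. q i * D i)" "order_le d p"
  shows "\<exists>n g. Poly_Mapping.keys (h ^ n * symb d p - (\<Sum>i\<in>UNIV. g i * L i)) \<subseteq> A"
proof -
  define small where "small r \<longleftrightarrow> Poly_Mapping.keys (normal_form r) \<subseteq> A" for r :: "'m weyl"
  have small_pow: "small (H ^ n * r)" if "small r" for n r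
    using that by (induction n) (auto simp: small_def mult.assoc intro!: A_left)
  have small_ell: "small (r * D i)" if "small r" for r i
    using that by (simp add: small_def A_right)
  have small_sum: "small (\<Sum>i\<in>UNIV. f i)" if "\<And>i. small (f i)" for f :: "'i \<Rightarrow> 'm weyl"
    using that unfolding small_def normal_form_sum by (intro keys_subset_sum)
  have small_add: "small (r + r')" if "small r" "small r'" for r r'
    using that unfolding small_def normal_form_simps by (intro keys_subset_add)
  have small_symb: "Poly_Mapping.keys (symb e r) \<subseteq> A" if "small r" for e r
    using that by (auto simp: small_def symb_def top_part_def)
  \<comment> \<open>The number \<open>x\<close> is the excess of the order of the representation over the order of \<open>H\<^sup>a p\<close>.\<close>
  have "\<exists>n g. Poly_Mapping.keys (h ^ n * symb d p - (\<Sum>i\<in>UNIV. g i * L i)) \<subseteq> A"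
    if "H ^ a * p = (\<Sum>i\<in>UNIV. q i * D i) + r" "small r" "\<And>i. order_le e (q i)"
      "e + s = d + int a * k + int x" for a q r e x
    using that
  proof (induction x arbitrary: a q r e)
    case 0
    have "h ^ a * symb d p = symb (int a * k + d) (H ^ a * p)"
      using symb_mult[OF order_le_power[OF H(1), of a] p(2)] symb_power[OF H(1), of a] H(2) by simp
    also have "int a * k + d = e + s" using 0 by simp
    also have "symb (e + s) (H ^ a * p) = (\<Sum>i\<in>UNIV. symb e (q i) * L i) + symb (e + s) r"
      unfolding 0(1) by (simp add: symb_add symb_sum symb_mult[OF 0(3) ord] sym)
    finally have "h ^ a * symb d p - (\<Sum>i\<in>UNIV. symb e (q i) * L i) = symb (e + s) r" by simp
    then show ?case using small_symb[OF 0(2), of "e + s"]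
      by (intro exI[of _ a] exI[of _ "\<lambda>i. symb e (q i)"]) simp
  next
    case (Suc x)
    have "order_le (int a * k + d) (H ^ a * p)"
      by (rule order_le_mult[OF order_le_power[OF H(1)] p(2)])
    then have "symb (e + s) (H ^ a * p) = 0"
      by (rule symb_eq_0) (use Suc.prems(4) in simp)
    then have "(\<Sum>i\<in>UNIV. symb e (q i) * L i) + symb (e + s) r = 0"
      unfolding Suc.prems(1) by (simp add: symb_add symb_sum symb_mult[OF Suc.prems(3) ord] sym)
    then have "(\<Sum>i\<in>UNIV. symb e (q i) * L i) = - symb (e + s) r"
      by (simp only: eq_neg_iff_add_eq_0)
    then have "Poly_Mapping.keys (\<Sum>i\<in>UNIV. symb e (q i) * L i) \<subseteq> A"
      using keys_subset_uminus[OF small_symb[OF Suc.prems(2)], of "e + s"] by (simp only:)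
    from syz[OF this] obtain n t where
      nt: "\<And>i. Poly_Mapping.keys (h ^ n * symb e (q i) - (\<Sum>j\<in>UNIV. (t i j - t j i) * L j)) \<subseteq> A"
      by blast
    define e' where "e' = int n * k + e"
    \<comment> \<open>Lift the Koszul coefficients and the error to operators, keeping only the parts of the relevant order.\<close>
    define T where "T i j = of_normal_form (top_part order_wt (e' - s) (t i j))" for i j
    define g where "g i = of_normal_form (top_part order_wt e' (h ^ n * symb e (q i) - (\<Sum>j\<in>UNIV. (t i j - t j i) * L j)))" for i
    have T: "order_le (e' - s) (T i j)" "symb (e' - s) (T i j) = top_part order_wt (e' - s) (t i j)" for i j
      by (simp_all add: T_def order_le_def symb_def of_normal_form_inverse weight_le_top_part top_part_idem)
    have g: "order_le e' (g i)" "small (g i)" "symb e' (g i) = normal_form (g i)" for i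
    proof -
      have n: "normal_form (g i) = top_part order_wt e' (h ^ n * symb e (q i) - (\<Sum>j\<in>UNIV. (t i j - t j i) * L j))"
        by (simp add: g_def of_normal_form_inverse)
      show "order_le e' (g i)" unfolding order_le_def n by (rule weight_le_top_part)
      show "symb e' (g i) = normal_form (g i)" unfolding symb_def n by (rule top_part_idem)
      show "small (g i)" using nt[of i] unfolding small_def n top_part_def by auto
    qed
    have Hq: "order_le e' (H ^ n * q i)" "symb e' (H ^ n * q i) = h ^ n * symb e (q i)" for i
      unfolding e'_def
      by (rule order_le_mult[OF order_le_power[OF H(1)] Suc.prems(3)])
        (simp add: symb_mult[OF order_le_power[OF H(1)] Suc.prems(3)] symb_power[OF H(1)] H(2))
    define Q where "Q i = H ^ n * q i - (\<Sum>j\<in>UNIV. (T i j - T j i) * D j) - g i" for i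
    have Tl: "order_le e' ((T i j - T j i) * D j)"
      "symb e' ((T i j - T j i) * D j) = top_part order_wt (e' - s) (t i j - t j i) * L j" for i j
      using order_le_mult[OF order_le_diff[OF T(1)[of i j] T(1)[of j i]] ord[of j]]
        symb_mult[OF order_le_diff[OF T(1)[of i j] T(1)[of j i]] ord[of j]]
      by (simp_all add: symb_diff T(2) sym top_part_diff)
    have L_hom: "top_part order_wt s (L i) = L i" "weight_le order_wt s (L i)" for i
      unfolding sym[symmetric] symb_def by (rule top_part_idem, rule weight_le_top_part)
    have "order_le (e' - 1) (Q i)" for i
    proof (rule order_le_drop)
      show "order_le e' (Q i)" unfolding Q_def by (intro order_le_diff order_le_sum Hq Tl g)
      have tp: "top_part order_wt e' (u * L j) = top_part order_wt (e' - s) u * L j" for u j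
        using top_part_mult_homogeneous[OF additive_order_wt L_hom(1), of "e' - s" u j] by simp
      have hom: "top_part order_wt e' (h ^ n * symb e (q i)) = h ^ n * symb e (q i)"
        by (metis Hq(2) symb_def top_part_idem)
      show "symb e' (Q i) = 0"
        unfolding Q_def symb_diff symb_sum Hq Tl g(3)
        by (simp add: g_def of_normal_form_inverse top_part_diff top_part_sum tp hom)
    qed
    moreover have "H ^ (n + a) * p = (\<Sum>i\<in>UNIV. Q i * D i) + ((\<Sum>i\<in>UNIV. g i * D i) + H ^ n * r)"
    proof -
      have "(\<Sum>i\<in>UNIV. (\<Sum>j\<in>UNIV. (T i j - T j i) * D j) * D i) =
        (\<Sum>i\<in>UNIV. \<Sum>j\<in>UNIV. T i j * D j * D i) - (\<Sum>i\<in>UNIV. \<Sum>j\<in>UNIV. T j i * D j * D i)"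
        by (simp add: sum_distrib_right left_diff_distrib sum_subtractf)
      also have "(\<Sum>i\<in>UNIV. \<Sum>j\<in>UNIV. T j i * D j * D i) = (\<Sum>i\<in>UNIV. \<Sum>j\<in>UNIV. T i j * D j * D i)"
        by (subst sum.swap) (simp add: mult.assoc comm)
      finally have "(\<Sum>i\<in>UNIV. (\<Sum>j\<in>UNIV. (T i j - T j i) * D j) * D i) = 0" by simp
      then have "(\<Sum>i\<in>UNIV. Q i * D i) = (\<Sum>i\<in>UNIV. H ^ n * q i * D i) - (\<Sum>i\<in>UNIV. g i * D i)"
        by (simp add: Q_def left_diff_distrib sum_subtractf)
      moreover have "H ^ (n + a) * p = (\<Sum>i\<in>UNIV. H ^ n * q i * D i) + H ^ n * r"
        by (simp add: power_add mult.assoc Suc.prems(1) distrib_left sum_distrib_left)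
      ultimately show ?thesis by simp
    qed
    moreover have "small ((\<Sum>i\<in>UNIV. g i * D i) + H ^ n * r)"
      by (intro small_add small_sum small_ell small_pow g Suc.prems)
    moreover have "(e' - 1) + s = d + int (n + a) * k + int x"
      using Suc.prems(4) by (simp add: e'_def algebra_simps)
    ultimately show ?case using Suc.IH by blast
  qed
  note step = this
  obtain e where e: "\<And>i. order_le e (q i)" "d - s \<le> e"
  proof -
    have "\<forall>i. \<exists>n\<ge>d - s. order_le n (q i)" using order_le_ex by blast
    then obtain n where n: "\<And>i. d - s \<le> n i" "\<And>i. order_le (n i) (q i)" by metis
    show ?thesis
    proof
      show "order_le (Max (range n)) (q i)" for i by (rule order_le_mono[OF n(2)]) simp
      show "d - s \<le> Max (range n)" using n(1) by (meson Max_ge finite UNIV_I image_eqI order_trans finite_imageI)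
    qed
  qed
  show ?thesis
    by (rule step[of 0 q 0 e "nat (e + s - d)"])
      (use e in \<open>auto simp: p(1) small_def normal_form_simps\<close>)
qed

section \<open>The hypergeometric operators commute\<close>

lemma theta_x: "wtheta i * wx j = wx j * wtheta i + (if i = j then wx i else 0)"
proof -
  have "wtheta i * wx j = wx i * (wd i * wx j)" by (simp add: wtheta_def mult.assoc)
  also have "\<dots> = wx i * wx j * wd i + (if i = j then wx i else 0)"
    by (simp add: wd_wx distrib_left mult.assoc)
  finally show ?thesis by (simp add: wtheta_def wx_wx[of i j] mult.assoc)
qed

lemma theta_d: "wd j * wtheta i = wtheta i * wd j + (if i = j then wd i else 0)"
proof -
  have "wd j * wtheta i = (wd j * wx i) * wd i" by (simp add: wtheta_def mult.assoc)
  also have "\<dots> = wx i * (wd j * wd i) + (if i = j then wd i else 0)"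
    by (auto simp: wd_wx distrib_right mult.assoc)
  finally show ?thesis by (simp add: wtheta_def wd_wd[of j i] mult.assoc)
qed

lemma theta_theta: "wtheta i * wtheta j = wtheta j * wtheta i"
proof (cases "i = j")
  case False
  have "wtheta i * wtheta j = (wtheta i * wx j) * wd j" by (simp add: wtheta_def mult.assoc)
  also have "\<dots> = wx j * (wtheta i * wd j)" using False by (simp add: theta_x mult.assoc)
  also have "wtheta i * wd j = wd j * wtheta i" using False by (simp add: theta_d)
  finally show ?thesis by (simp add: wtheta_def[of j] mult.assoc)
qed simp

lemma theta_total_x: "wtheta_total * wx j = wx j * (wtheta_total + 1)"
proof -
  have "wtheta_total * wx j = (\<Sum>i\<in>UNIV. wx j * wtheta i + (if i = j then wx i else 0))"
    by (simp add: wtheta_total_def sum_distrib_right theta_x)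
  then show ?thesis
    by (simp add: sum.distrib distrib_left wtheta_total_def sum_distrib_left)
qed

lemma theta_theta_total: "wtheta i * wtheta_total = wtheta_total * wtheta i"
  by (simp add: wtheta_total_def sum_distrib_left sum_distrib_right theta_theta)

lemma mult_skew:
  fixes u v x :: "'r::ring_1"
  assumes "u * x = x * u'" "v * x = x * v'"
  shows "u * v * x = x * (u' * v')"
proof -
  have "u * v * x = u * (v * x)" by (simp add: mult.assoc)
  also have "\<dots> = u * x * v'" by (simp add: assms(2) mult.assoc)
  finally show ?thesis by (simp add: assms(1) mult.assoc)
qed

lemma add_skew:
  fixes u v x :: "'r::ring_1"
  assumes "u * x = x * u'" "v * x = x * v'"
  shows "(u + v) * x = x * (u' + v')"
  using assms by (simp add: distrib_left distrib_right)

text \<open>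
  The operators have the shape \<open>P - x E\<close>, where moving \<open>x\<close> and \<open>y\<close> past \<open>E\<close> shifts \<open>E\<close> to the same \<open>E'\<close>,
  so that \<open>x E y E = x y E' E\<close> is symmetric in \<open>x\<close> and \<open>y\<close>.
\<close>

lemma skew_commute:
  fixes P Q x y E E' :: "'r::ring_1"
  assumes "P * Q = Q * P" "P * y = y * P" "Q * x = x * Q" "P * E = E * P" "Q * E = E * Q"
    and "E * x = x * E'" "E * y = y * E'" "x * y = y * x"
  shows "(P - x * E) * (Q - y * E) = (Q - y * E) * (P - x * E)"
proof -
  have "P * (y * E) = y * E * P" "Q * (x * E) = x * E * Q"
    by (rule mult_skew[symmetric]; simp add: assms)+
  moreover have "x * E * (y * E) = y * E * (x * E)"
  proof -
    have "x * E * (y * E) = x * (E * y) * E" by (simp add: mult.assoc)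
    also have "\<dots> = x * y * (E' * E)" by (simp add: assms(7) mult.assoc)
    also have "\<dots> = y * (x * E') * E" by (simp add: assms(8) mult.assoc)
    also have "\<dots> = y * E * (x * E)" by (simp add: assms(6)[symmetric] mult.assoc)
    finally show ?thesis .
  qed
  ultimately show ?thesis using assms(1) by (simp add: algebra_simps)
qed

text \<open>
  Here \<open>E = (\<theta> + a)(\<theta> + b)\<close>, and \<open>\<theta> x\<^sub>i = x\<^sub>i (\<theta> + 1)\<close> gives the shifted operator \<open>E'\<close>.
\<close>

lemma ell_commute:
  fixes i j :: "'m::finite"
  shows "ell a b c i * ell a b c j = ell a b c j * ell a b c i"
proof (cases "i = j")
  case False
  define P where "P i = wtheta i * (wtheta i + wconst (c $ i - 1))" for i :: 'm
  define E :: "'m weyl" where "E = (wtheta_total + wconst a) * (wtheta_total + wconst b)"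
  define E' :: "'m weyl" where "E' = (wtheta_total + 1 + wconst a) * (wtheta_total + 1 + wconst b)"
  have ell: "ell a b c i = P i - wx i * E" for i
    by (simp add: ell_def P_def E_def mult.assoc)
  have c1: "wtheta i * (wtheta j + wconst d) = (wtheta j + wconst d) * wtheta i" for i j :: 'm and d
    by (intro add_skew add_skew[symmetric] theta_theta wconst_comm wconst_comm[symmetric])
  have c2: "(wtheta i + wconst e) * (wtheta j + wconst d) = (wtheta j + wconst d) * (wtheta i + wconst e)"
    for i j :: 'm and d e
    by (intro add_skew add_skew[symmetric] theta_theta wconst_comm wconst_comm[symmetric])
  have P_P: "P i * P j = P j * P i" for i j
    unfolding P_def by (intro mult_skew mult_skew[symmetric] c1 c2 theta_theta c1[symmetric])
  have P_x: "P i * wx j = wx j * P i" if "i \<noteq> j" for i j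
  proof -
    have "(wtheta i + wconst d) * wx j = wx j * (wtheta i + wconst d)" for d
      by (intro add_skew wconst_comm) (use that in \<open>simp add: theta_x\<close>)
    moreover have "wtheta i * wx j = wx j * wtheta i" using that by (simp add: theta_x)
    ultimately show ?thesis unfolding P_def by (intro mult_skew)
  qed
  have c3: "(wtheta i + wconst d) * (wtheta_total + wconst e) = (wtheta_total + wconst e) * (wtheta i + wconst d)"
    for i :: 'm and d e
    by (intro add_skew add_skew[symmetric] theta_theta_total theta_theta_total[symmetric] wconst_comm wconst_comm[symmetric])
  have c4: "wtheta i * (wtheta_total + wconst e) = (wtheta_total + wconst e) * wtheta i" for i :: 'm and e
    by (intro add_skew add_skew[symmetric] theta_theta_total theta_theta_total[symmetric] wconst_comm wconst_comm[symmetric])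
  have P_E: "P i * E = E * P i" for i
    unfolding P_def E_def by (intro mult_skew mult_skew[symmetric] c3 c4 c3[symmetric] c4[symmetric])
  have "(wtheta_total + wconst e) * wx i = wx i * (wtheta_total + 1 + wconst e)" for e and i :: 'm
    by (intro add_skew theta_total_x wconst_comm)
  then have E_x: "E * wx i = wx i * E'" for i
    unfolding E_def E'_def by (intro mult_skew)
  show ?thesis
    unfolding ell
    by (rule skew_commute) (use False in \<open>auto intro: P_P P_x P_E E_x wx_wx\<close>)
qed simp

section \<open>The symbols of the hypergeometric operators\<close>

definition x_symb :: "'m \<Rightarrow> 'm::finite symb_poly" where
  "x_symb i = Poly_Mapping.single (unit_exp i, 0) 1"

definition theta_symb :: "'m \<Rightarrow> 'm::finite symb_poly" where
  "theta_symb i = Poly_Mapping.single (unit_exp i, unit_exp i) 1"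

definition theta_total_symb :: "'m::finite symb_poly" where
  "theta_total_symb = (\<Sum>i\<in>UNIV. theta_symb i)"

definition ell_symb :: "'m \<Rightarrow> 'm::finite symb_poly" where
  "ell_symb i = theta_symb i ^ 2 - x_symb i * theta_total_symb ^ 2"

lemma normal_form_wmono: "normal_form (wmono c \<alpha> \<beta>) = Poly_Mapping.single (\<alpha>, \<beta>) c"
  by (simp add: wmono_def of_normal_form_inverse)

lemma order_le_wmono: "int (exp_degree \<beta>) \<le> n \<Longrightarrow> order_le n (wmono c \<alpha> \<beta>)"
  by (simp add: order_le_def normal_form_wmono weight_le_single order_wt_def)

lemma symb_wmono: "symb n (wmono c \<alpha> \<beta>) = (if int (exp_degree \<beta>) = n then Poly_Mapping.single (\<alpha>, \<beta>) c else 0)"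
  by (simp add: symb_def normal_form_wmono top_part_def part_single order_wt_def)

lemma order_le_wtheta: "order_le 1 (wtheta i)"
  and symb_wtheta: "symb 1 (wtheta i) = theta_symb i"
  by (simp_all add: wtheta_def wx_def wd_def wmono_mult_x order_le_wmono symb_wmono theta_symb_def)

lemma order_le_wtheta_total: "order_le 1 wtheta_total"
  and symb_wtheta_total: "symb 1 wtheta_total = theta_total_symb"
  by (simp_all add: wtheta_total_def theta_total_symb_def order_le_sum order_le_wtheta symb_sum symb_wtheta)

lemma order_le_wconst: "order_le 1 (wconst c)"
  and symb_wconst: "symb 1 (wconst c) = 0"
  by (simp_all add: wconst_def order_le_wmono symb_wmono)

lemma order_le_ell: "order_le 2 (ell a b c i)"
  and symb_ell: "symb 2 (ell a b c i) = ell_symb i"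
proof -
  have x: "order_le 0 (wx i)" "symb 0 (wx i) = x_symb i"
    by (simp_all add: wx_def x_symb_def order_le_wmono symb_wmono)
  have t: "order_le 1 (wtheta i + wconst d)" "symb 1 (wtheta i + wconst d) = theta_symb i" for d
    by (simp_all add: order_le_add order_le_wtheta order_le_wconst symb_add symb_wtheta symb_wconst)
  have T: "order_le 1 (wtheta_total + wconst d :: 'a weyl)"
      "symb 1 (wtheta_total + wconst d :: 'a weyl) = theta_total_symb" for d
    by (simp_all add: order_le_add order_le_wtheta_total order_le_wconst symb_add symb_wtheta_total symb_wconst)
  have u: "order_le 2 (wtheta i * (wtheta i + wconst d))"
      "symb 2 (wtheta i * (wtheta i + wconst d)) = theta_symb i ^ 2" for d
    using order_le_mult[OF order_le_wtheta[of i] t(1)[of d]] symb_mult[OF order_le_wtheta[of i] t(1)[of d]]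
    by (simp_all add: t(2) symb_wtheta power2_eq_square)
  have v: "order_le 1 (wx i * (wtheta_total + wconst a))" "symb 1 (wx i * (wtheta_total + wconst a)) = x_symb i * theta_total_symb"
    using order_le_mult[OF x(1) T(1)[of a]] symb_mult[OF x(1) T(1)[of a]] by (simp_all add: x T)
  have w: "order_le 2 (wx i * (wtheta_total + wconst a) * (wtheta_total + wconst b))"
    "symb 2 (wx i * (wtheta_total + wconst a) * (wtheta_total + wconst b)) = x_symb i * theta_total_symb ^ 2"
    using order_le_mult[OF v(1) T(1)[of b]] symb_mult[OF v(1) T(1)[of b]]
    by (simp_all add: v T power2_eq_square mult.assoc)
  show "order_le 2 (ell a b c i)" "symb 2 (ell a b c i) = ell_symb i"
    by (simp_all add: ell_def ell_symb_def order_le_diff symb_diff u w)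
qed

lemma hypergeometric_ideal_combination:
  assumes "p \<in> hypergeometric_ideal a b c"
  obtains q where "p = (\<Sum>i\<in>UNIV. q i * ell a b c i)"
proof -
  let ?J = "{\<Sum>i\<in>UNIV. q i * ell a b c i | q. True}"
  have "left_ideal ?J"
    unfolding left_ideal_def
  proof (intro conjI ballI allI)
    show "0 \<in> ?J" by (auto intro!: exI[of _ "\<lambda>_. 0"])
  next
    fix p q assume "p \<in> ?J" "q \<in> ?J"
    then obtain f g where "p = (\<Sum>i\<in>UNIV. f i * ell a b c i)" "q = (\<Sum>i\<in>UNIV. g i * ell a b c i)" by auto
    then have "p + q = (\<Sum>i\<in>UNIV. (f i + g i) * ell a b c i)" by (simp add: distrib_right sum.distrib)
    then show "p + q \<in> ?J" by (auto intro!: exI[of _ "\<lambda>i. f i + g i"])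
  next
    fix r p assume "p \<in> ?J"
    then obtain f where "p = (\<Sum>i\<in>UNIV. f i * ell a b c i)" by auto
    then have "r * p = (\<Sum>i\<in>UNIV. (r * f i) * ell a b c i)" by (simp add: sum_distrib_left mult.assoc)
    then show "r * p \<in> ?J" by (auto intro!: exI[of _ "\<lambda>i. r * f i"])
  qed
  moreover have "range (ell a b c) \<subseteq> ?J"
  proof
    fix z assume "z \<in> range (ell a b c)"
    then obtain k where "z = ell a b c k" by auto
    then have "z = (\<Sum>i\<in>UNIV. (if i = k then 1 else 0) * ell a b c i)" by (simp add: if_distrib[of "\<lambda>x. x * _"] cong: if_cong)
    then show "z \<in> ?J" by (auto intro!: exI[of _ "\<lambda>i. if i = k then 1 else 0"])
  qed
  ultimately have "hypergeometric_ideal a b c \<subseteq> ?J"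
    unfolding hypergeometric_ideal_def left_ideal_generated_def by (intro hull_minimal)
  with assms that show thesis by auto
qed

section \<open>Syzygies of the symbols near the origin\<close>

lemma theta_symb_power: "theta_symb i ^ n = Poly_Mapping.single (\<lambda>j. if j = i then n else 0, \<lambda>j. if j = i then n else 0) 1"
proof (induction n)
  case 0
  have "(\<lambda>j. if j = i then 0 else 0) = (0 :: 'a \<Rightarrow> nat)" by auto
  then show ?case by (simp flip: zero_prod_def)
next
  case (Suc n)
  have "unit_exp i + (\<lambda>j. if j = i then n else 0) = (\<lambda>j. if j = i then Suc n else 0)" by auto
  then show ?case
    unfolding power_Suc Suc by (simp only: theta_symb_def mult_single add_Pair mult_1_right)
qed

text \<open>
  The squares \<open>(x\<^sub>i \<xi>\<^sub>i)\<^sup>2\<close> are pairwise coprime monomials. Division by one of them just separates the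
  multiples of this monomial from the other monomials, so no multiplier is necessary.
\<close>

lemma koszul_theta_symb_square:
  fixes g :: "'m::finite \<Rightarrow> 'm symb_poly"
  assumes "(\<Sum>i\<in>UNIV. g i * theta_symb i ^ 2) = 0"
  shows "\<exists>t. \<forall>i. g i = (\<Sum>j\<in>UNIV. (t i j - t j i) * theta_symb j ^ 2)"
proof -
  define l :: "'m \<Rightarrow> 'm bimono" where "l i = (\<lambda>j. if j = i then 2 else 0, \<lambda>j. if j = i then 2 else 0)" for i
  have theta_symb: "theta_symb i ^ 2 = Poly_Mapping.single (l i) 1" for i by (simp only: theta_symb_power l_def)
  define B :: "'m \<Rightarrow> 'm bimono set" where "B k = {\<kappa>. \<not> (2 \<le> fst \<kappa> k \<and> 2 \<le> snd \<kappa> k)}" for k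
  have "\<exists>n t. \<forall>i\<in>UNIV. (1 :: 'm symb_poly) ^ n * g i = (\<Sum>j\<in>UNIV. (t i j - t j i) * theta_symb j ^ 2)"
  proof (rule koszul_syzygies[where N = "\<lambda>k. {p. Poly_Mapping.keys p \<subseteq> B k}"])
    fix k and p q :: "'m symb_poly"
    assume "p \<in> {p. Poly_Mapping.keys p \<subseteq> B k}" "q \<in> {p. Poly_Mapping.keys p \<subseteq> B k}"
    then show "p + q \<in> {p. Poly_Mapping.keys p \<subseteq> B k}" by (simp add: keys_subset_add)
  next
    fix i k and p :: "'m symb_poly"
    assume ik: "i \<noteq> k" and p: "p \<in> {p. Poly_Mapping.keys p \<subseteq> B k}"
    have "Poly_Mapping.keys (p * theta_symb i ^ 2) \<subseteq> B k"
    proof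
      fix \<kappa> assume "\<kappa> \<in> Poly_Mapping.keys (p * theta_symb i ^ 2)"
      then obtain u where u: "\<kappa> = u + l i" "u \<in> Poly_Mapping.keys p"
        using keys_mult[of p "Poly_Mapping.single (l i) 1"] unfolding theta_symb by fastforce
      then have "u \<in> B k" using p by auto
      then show "\<kappa> \<in> B k" using ik by (simp add: u(1) B_def l_def)
    qed
    then show "p * theta_symb i ^ 2 \<in> {p. Poly_Mapping.keys p \<subseteq> B k}" by simp
  next
    fix k and b :: "'m symb_poly"
    assume b: "theta_symb k ^ 2 * b \<in> {p. Poly_Mapping.keys p \<subseteq> B k}"
    show "b = 0"
    proof (rule poly_mapping_eqI)
      fix \<kappa>
      have "l k + \<kappa> \<notin> B k" by (simp add: B_def l_def)
      then have "Poly_Mapping.lookup (theta_symb k ^ 2 * b) (l k + \<kappa>) = 0"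
        using b by (auto simp: in_keys_iff)
      then show "Poly_Mapping.lookup b \<kappa> = Poly_Mapping.lookup 0 \<kappa>"
        by (simp add: theta_symb lookup_single_mult)
    qed
  next
    fix k and p :: "'m symb_poly"
    have "\<exists>a b. Poly_Mapping.keys a \<subseteq> B k \<and> p = a + theta_symb k ^ 2 * b"
    proof (induction p rule: symb_poly_induct)
      case (single \<kappa> c)
      show ?case
      proof (cases "\<kappa> \<in> B k")
        case True
        then show ?thesis by (intro exI[of _ "Poly_Mapping.single \<kappa> c"] exI[of _ 0]) simp
      next
        case False
        then have "\<kappa> = l k + (fst \<kappa> - fst (l k), snd \<kappa> - snd (l k))"
          by (auto simp: B_def l_def prod_eq_iff fun_eq_iff)
        then have "Poly_Mapping.single \<kappa> c = 0 + theta_symb k ^ 2 * Poly_Mapping.single (fst \<kappa> - fst (l k), snd \<kappa> - snd (l k)) c"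
          unfolding theta_symb mult_single by simp
        then show ?thesis by (intro exI[of _ 0] conjI exI) (simp, assumption)
      qed
    next
      case (add p q)
      then obtain a b a' b' where "Poly_Mapping.keys a \<subseteq> B k" "p = a + theta_symb k ^ 2 * b"
        "Poly_Mapping.keys a' \<subseteq> B k" "q = a' + theta_symb k ^ 2 * b'" by blast
      then show ?case
        by (intro exI[of _ "a + a'"] exI[of _ "b + b'"]) (simp add: keys_subset_add algebra_simps)
    qed
    then show "\<exists>n0. \<forall>n\<ge>n0. \<exists>a b. a \<in> {p. Poly_Mapping.keys p \<subseteq> B k} \<and> (1 :: 'm symb_poly) ^ n * p = a + theta_symb k ^ 2 * b"
      by simp
  qed (use assms in simp_all)
  then show ?thesis by simp
qed

lemma antisym_sum_zero:
  fixes f :: "'i::finite \<Rightarrow> 'r::comm_ring_1"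
  shows "(\<Sum>i\<in>UNIV. (\<Sum>j\<in>UNIV. (t i j - t j i) * f j) * f i) = 0"
proof -
  have "(\<Sum>i\<in>UNIV. (\<Sum>j\<in>UNIV. (t i j - t j i) * f j) * f i) =
    (\<Sum>i\<in>UNIV. \<Sum>j\<in>UNIV. t i j * f j * f i) - (\<Sum>i\<in>UNIV. \<Sum>j\<in>UNIV. t j i * f j * f i)"
    by (simp add: sum_distrib_right left_diff_distrib sum_subtractf)
  also have "(\<Sum>i\<in>UNIV. \<Sum>j\<in>UNIV. t j i * f j * f i) = (\<Sum>i\<in>UNIV. \<Sum>j\<in>UNIV. t i j * f j * f i)"
    by (subst sum.swap) (simp add: mult_ac)
  finally show ?thesis by simp
qed

lemma V_wt_x_symb: "V_wt (unit_exp i, 0) = -1" and V_wt_theta_symb: "V_wt (unit_exp i, unit_exp i) = 0"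
  by (simp_all add: V_wt_def)

lemma
  shows weight_le_V_wt_ell_symb: "weight_le V_wt 0 (ell_symb i)"
    and top_part_V_wt_ell_symb: "top_part V_wt 0 (ell_symb i) = theta_symb i ^ 2"
proof -
  have theta_symb: "weight_le V_wt 0 (theta_symb i)" "top_part V_wt 0 (theta_symb i) = theta_symb i" for i :: 'a
    by (simp_all add: theta_symb_def weight_le_single V_wt_theta_symb top_part_def part_single)
  have theta_total_symb: "weight_le V_wt 0 (theta_total_symb :: 'a symb_poly)" unfolding theta_total_symb_def by (intro weight_le_sum theta_symb)
  have x_symb: "weight_le V_wt (-1) (x_symb i)" by (simp add: x_symb_def weight_le_single V_wt_x_symb)
  have 1: "weight_le V_wt 0 (theta_symb i ^ 2)" "top_part V_wt 0 (theta_symb i ^ 2) = theta_symb i ^ 2"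
    using weight_le_mult[OF additive_V_wt theta_symb(1)[of i] theta_symb(1)[of i]] top_part_mult[OF additive_V_wt theta_symb(1)[of i] theta_symb(1)[of i]]
    by (simp_all add: power2_eq_square theta_symb)
  have 2: "weight_le V_wt (-1) (x_symb i * theta_total_symb ^ 2)"
    using weight_le_mult[OF additive_V_wt x_symb weight_le_mult[OF additive_V_wt theta_total_symb theta_total_symb]] by (simp add: power2_eq_square)
  show "weight_le V_wt 0 (ell_symb i)"
    unfolding ell_symb_def by (intro weight_le_diff 1 weight_le_mono[OF 2]) simp
  show "top_part V_wt 0 (ell_symb i) = theta_symb i ^ 2"
    unfolding ell_symb_def top_part_diff 1 by (simp add: top_part_eq_0[OF 2])
qed

text \<open>
  For the weight \<open>V_wt\<close> the leading form of \<open>L\<^sub>i = (x\<^sub>i \<xi>\<^sub>i)\<^sup>2 - x\<^sub>i (\<Sum> x\<^sub>j \<xi>\<^sub>j)\<^sup>2\<close> is the monomial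
  \<open>(x\<^sub>i \<xi>\<^sub>i)\<^sup>2\<close>. Hence the leading coefficients of a syzygy are a Koszul combination of these monomials, and
  replacing the monomials by the \<open>L\<^sub>i\<close> removes the leading part. Since the weight is not bounded below, this
  process need not stop, but it reaches every prescribed weight \<open>n\<close>.
\<close>

lemma koszul_ell_symb_at_0:
  fixes g :: "'m::finite \<Rightarrow> 'm symb_poly"
  assumes "weight_le V_wt n (\<Sum>i\<in>UNIV. g i * ell_symb i)"
  shows "\<exists>t. \<forall>i. weight_le V_wt n (g i - (\<Sum>j\<in>UNIV. (t i j - t j i) * ell_symb j))"
proof -
  have "\<exists>t. \<forall>i. weight_le V_wt n (g i - (\<Sum>j\<in>UNIV. (t i j - t j i) * ell_symb j))"
    if "\<And>i. weight_le V_wt (n + int x) (g i)" "weight_le V_wt n (\<Sum>i\<in>UNIV. g i * ell_symb i)"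
    for x and g :: "'m \<Rightarrow> 'm symb_poly"
    using that
  proof (induction x arbitrary: g)
    case 0
    then show ?case by (intro exI[of _ "\<lambda>_ _. 0"]) simp
  next
    case (Suc x)
    define m where "m = n + int (Suc x)"
    have g: "weight_le V_wt m (g i)" for i using Suc.prems(1) by (simp add: m_def)
    have tp: "top_part V_wt m (u * ell_symb i) = top_part V_wt m u * theta_symb i ^ 2" if "weight_le V_wt m u" for u i
      using top_part_mult[OF additive_V_wt that weight_le_V_wt_ell_symb[of i]] by (simp add: top_part_V_wt_ell_symb)
    have "top_part V_wt m (\<Sum>i\<in>UNIV. g i * ell_symb i) = 0"
      by (rule top_part_eq_0[OF Suc.prems(2)]) (simp add: m_def)
    then have "(\<Sum>i\<in>UNIV. top_part V_wt m (g i) * theta_symb i ^ 2) = 0"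
      by (simp add: top_part_sum tp g)
    from koszul_theta_symb_square[OF this] obtain t
      where t: "\<And>i. top_part V_wt m (g i) = (\<Sum>j\<in>UNIV. (t i j - t j i) * theta_symb j ^ 2)" by blast
    define t' where "t' i j = top_part V_wt m (t i j)" for i j
    have t': "weight_le V_wt m (t' i j - t' j i)" for i j
      unfolding t'_def by (intro weight_le_diff weight_le_top_part)
    define g' where "g' i = g i - (\<Sum>j\<in>UNIV. (t' i j - t' j i) * ell_symb j)" for i
    have "weight_le V_wt (m - 1) (g' i)" for i
    proof (rule weight_le_drop_top)
      show "weight_le V_wt m (g' i)"
        unfolding g'_def
        using weight_le_mult[OF additive_V_wt t' weight_le_V_wt_ell_symb] by (intro weight_le_diff g weight_le_sum) simp
      have theta_symb: "top_part V_wt 0 (theta_symb j ^ 2) = theta_symb j ^ 2" for j :: 'm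
        using top_part_idem[of V_wt 0 "ell_symb j"] by (simp add: top_part_V_wt_ell_symb)
      have hom: "top_part V_wt m (u * theta_symb j ^ 2) = top_part V_wt m u * theta_symb j ^ 2" for u and j :: 'm
        using top_part_mult_homogeneous[OF additive_V_wt theta_symb, of m u j] by simp
      have "top_part V_wt m (g i) = top_part V_wt m (top_part V_wt m (g i))" by (simp only: top_part_idem)
      also have "\<dots> = (\<Sum>j\<in>UNIV. (t' i j - t' j i) * theta_symb j ^ 2)"
        unfolding t top_part_sum
        by (simp add: t'_def hom top_part_diff)
      finally show "top_part V_wt m (g' i) = 0"
        unfolding g'_def top_part_diff top_part_sum tp[OF t']
        by (simp add: t'_def top_part_idem top_part_diff)
    qed
    then have "weight_le V_wt (n + int x) (g' i)" for i by (simp add: m_def)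
    moreover have "(\<Sum>i\<in>UNIV. g' i * ell_symb i) = (\<Sum>i\<in>UNIV. g i * ell_symb i)"
      unfolding g'_def by (simp only: left_diff_distrib[of "g _"] sum_subtractf antisym_sum_zero diff_0_right)
    ultimately obtain s where s: "\<And>i. weight_le V_wt n (g' i - (\<Sum>j\<in>UNIV. (s i j - s j i) * ell_symb j))"
      using Suc.IH[of g'] Suc.prems(2) by auto
    have "g i - (\<Sum>j\<in>UNIV. (s i j + t' i j - (s j i + t' j i)) * ell_symb j) =
      g' i - (\<Sum>j\<in>UNIV. (s i j - s j i) * ell_symb j)" for i
    proof -
      have "(\<Sum>j\<in>UNIV. (s i j + t' i j - (s j i + t' j i)) * ell_symb j) =
        (\<Sum>j\<in>UNIV. (t' i j - t' j i) * ell_symb j + (s i j - s j i) * ell_symb j)"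
        by (intro sum.cong refl) (simp add: algebra_simps)
      then show ?thesis by (simp add: g'_def sum.distrib)
    qed
    with s show ?case by (intro exI[of _ "\<lambda>i j. s i j + t' i j"]) simp
  qed
  note step = this
  have "\<forall>i. \<exists>m. weight_le V_wt m (g i)"
    by (metis weight_le_zero weight_le_attained)
  then obtain m where m: "\<And>i. weight_le V_wt (m i) (g i)" by metis
  let ?M = "Max (insert n (range m))"
  have "weight_le V_wt (n + int (nat (?M - n))) (g i)" for i
  proof (rule weight_le_mono[OF m])
    have "m i \<le> ?M" "n \<le> ?M" by (rule Max_ge; simp)+
    then show "m i \<le> n + int (nat (?M - n))" by linarith
  qed
  from step[OF this assms] show ?thesis .
qed

section \<open>Symbols vanish where all products of position and momentum vanish\<close>

text \<open>
  Membership in the monomial ideal generated by the \<open>x\<^sub>j \<xi>\<^sub>j\<close>.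
\<close>

definition in_theta_ideal :: "'m symb_poly \<Rightarrow> bool" where
  "in_theta_ideal p \<longleftrightarrow> (\<forall>\<kappa>\<in>Poly_Mapping.keys p. \<exists>j. 1 \<le> fst \<kappa> j \<and> 1 \<le> snd \<kappa> j)"

lemma in_theta_ideal_add: "in_theta_ideal p \<Longrightarrow> in_theta_ideal q \<Longrightarrow> in_theta_ideal (p + q)"
  using keys_add[of p q] by (auto simp: in_theta_ideal_def)

lemma in_theta_ideal_diff: "in_theta_ideal p \<Longrightarrow> in_theta_ideal q \<Longrightarrow> in_theta_ideal (p - q)"
  using keys_diff[of p q] by (auto simp: in_theta_ideal_def)

lemma in_theta_ideal_sum: "(\<And>i. i \<in> I \<Longrightarrow> in_theta_ideal (f i)) \<Longrightarrow> in_theta_ideal (sum f I)"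
  by (induction I rule: infinite_finite_induct) (simp_all add: in_theta_ideal_add, simp_all add: in_theta_ideal_def)

lemma in_theta_ideal_mult: "in_theta_ideal q \<Longrightarrow> in_theta_ideal (p * q)"
  unfolding in_theta_ideal_def
proof
  fix \<kappa> assume q: "\<forall>\<kappa>\<in>Poly_Mapping.keys q. \<exists>j. 1 \<le> fst \<kappa> j \<and> 1 \<le> snd \<kappa> j"
    and "\<kappa> \<in> Poly_Mapping.keys (p * q)"
  then obtain u v where uv: "\<kappa> = u + v" "v \<in> Poly_Mapping.keys q"
    using keys_mult[of p q] by blast
  with q obtain j where "1 \<le> fst v j" "1 \<le> snd v j" by blast
  then show "\<exists>j. 1 \<le> fst \<kappa> j \<and> 1 \<le> snd \<kappa> j" by (auto simp: uv intro!: exI[of _ j])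
qed

lemma in_theta_ideal_ell_symb:
  fixes i :: "'m::finite"
  shows "in_theta_ideal (ell_symb i)"
proof -
  have y: "in_theta_ideal (theta_symb i)" for i :: 'm by (auto simp: in_theta_ideal_def theta_symb_def intro!: exI[of _ i])
  then have "in_theta_ideal (theta_total_symb :: 'm symb_poly)" unfolding theta_total_symb_def by (intro in_theta_ideal_sum)
  with y show ?thesis unfolding ell_symb_def power2_eq_square by (intro in_theta_ideal_diff in_theta_ideal_mult)
qed

lemma weight_le_V_wt_ell: "weight_le V_wt 0 (normal_form (ell a b c i))"
proof -
  define V where "V n p \<longleftrightarrow> weight_le V_wt n (normal_form p)" for n and p :: "'a weyl"
  have mono: "V n (wmono c \<alpha> \<beta>)" if "V_wt (\<alpha>, \<beta>) \<le> n" for c \<alpha> \<beta> n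
    using that by (simp add: V_def normal_form_wmono weight_le_single)
  have mult: "V 0 (p * q)" if "V 0 p" "V 0 q" for p q
    using weight_le_V_wt_nf_mult[of 0 "normal_form p" 0 "normal_form q"] that by (simp add: V_def normal_form_simps)
  have add: "V 0 (p + q)" "V 0 (p - q)" if "V 0 p" "V 0 q" for p q
    using that by (simp_all add: V_def normal_form_simps weight_le_add weight_le_diff)
  have x: "V 0 (wx i)" for i by (simp add: wx_def mono V_wt_def)
  have c: "V 0 (wconst d)" for d by (simp add: wconst_def mono V_wt_def)
  have t: "V 0 (wtheta i)" for i
    unfolding wtheta_def wx_def wd_def wmono_mult_x by (rule mono) (simp add: V_wt_def)
  then have T: "V 0 wtheta_total"
    unfolding wtheta_total_def V_def normal_form_sum by (intro weight_le_sum)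
  have "V 0 (ell a b c i)" unfolding ell_def by (intro add mult x c t T)
  then show ?thesis by (simp add: V_def)
qed

text \<open>
  By \<open>descent\<close>, the symbol lies in the ideal of the \<open>L\<^sub>i\<close> up to an error of arbitrarily low weight
  \<open>V_wt\<close>. An individual monomial is not affected by an error of lower weight, and all monomials in the
  ideal of the \<open>L\<^sub>i\<close> are divisible by some \<open>x\<^sub>j \<xi>\<^sub>j\<close>.
\<close>

lemma symb_in_theta_ideal:
  fixes p :: "'m::finite weyl"
  assumes p: "p \<in> hypergeometric_ideal a b c" "order_le d p"
  shows "in_theta_ideal (symb d p)"
  unfolding in_theta_ideal_def
proof
  fix \<kappa> assume \<kappa>: "\<kappa> \<in> Poly_Mapping.keys (symb d p)"
  \<comment> \<open>Errors are negligible if their weight is below that of the monomial under consideration.\<close>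
  let ?A = "{k :: 'm bimono. V_wt k \<le> V_wt \<kappa> - 1}"
  obtain q where q: "p = (\<Sum>i\<in>UNIV. q i * ell a b c i)"
    using p(1) by (rule hypergeometric_ideal_combination)
  have "\<exists>n g. Poly_Mapping.keys ((1::'m symb_poly) ^ n * symb d p - (\<Sum>i\<in>UNIV. g i * ell_symb i)) \<subseteq> ?A"
  proof (rule descent[where D = "ell a b c" and s = 2 and H = 1 and k = 0 and L = ell_symb])
    fix r :: "'m weyl" and i
    assume "Poly_Mapping.keys (normal_form r) \<subseteq> ?A"
    then show "Poly_Mapping.keys (normal_form (r * ell a b c i)) \<subseteq> ?A"
      using weight_le_V_wt_nf_mult[OF _ weight_le_V_wt_ell, of "V_wt \<kappa> - 1" "normal_form r" a b c i]
      by (simp add: weight_le_def normal_form_simps)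
  next
    fix g :: "'m \<Rightarrow> 'm symb_poly"
    assume "Poly_Mapping.keys (\<Sum>i\<in>UNIV. g i * ell_symb i) \<subseteq> ?A"
    then show "\<exists>n t. \<forall>i. Poly_Mapping.keys (1 ^ n * g i - (\<Sum>j\<in>UNIV. (t i j - t j i) * ell_symb j)) \<subseteq> ?A"
      using koszul_ell_symb_at_0[of "V_wt \<kappa> - 1" g] by (simp add: weight_le_def)
  qed (use q p(2) in \<open>auto intro: ell_commute order_le_ell symb_ell order_le_one symb_one\<close>)
  then obtain g where g: "Poly_Mapping.keys (symb d p - (\<Sum>i\<in>UNIV. g i * ell_symb i)) \<subseteq> ?A" by auto
  have "\<kappa> \<notin> ?A" by simp
  with g have "\<kappa> \<notin> Poly_Mapping.keys (symb d p - (\<Sum>i\<in>UNIV. g i * ell_symb i))" by blast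
  with \<kappa> have "\<kappa> \<in> Poly_Mapping.keys (\<Sum>i\<in>UNIV. g i * ell_symb i)"
    by (simp add: in_keys_iff lookup_minus)
  moreover have "in_theta_ideal (\<Sum>i\<in>UNIV. g i * ell_symb i)"
    by (intro in_theta_ideal_sum in_theta_ideal_mult in_theta_ideal_ell_symb)
  ultimately show "\<exists>j. 1 \<le> fst \<kappa> j \<and> 1 \<le> snd \<kappa> j" by (simp add: in_theta_ideal_def)
qed

section \<open>Syzygies of the symbols away from the coordinate hyperplanes\<close>

definition excess :: "'m \<Rightarrow> 'm bimono \<Rightarrow> int" where
  "excess k \<kappa> = int (fst \<kappa> k) - int (snd \<kappa> k)"

lemma additive_excess [simp]: "additive_weight (excess k)"
  by (simp add: additive_weight_def excess_def)

definition homog :: "('k \<Rightarrow> int) \<Rightarrow> int \<Rightarrow> ('k \<Rightarrow>\<^sub>0 complex) \<Rightarrow> bool" where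
  "homog \<phi> n p \<longleftrightarrow> Poly_Mapping.keys p \<subseteq> {k. \<phi> k = n}"

lemma homog_single: "\<phi> k = n \<Longrightarrow> homog \<phi> n (Poly_Mapping.single k c)"
  and homog_0: "homog \<phi> n 0"
  and homog_add: "homog \<phi> n p \<Longrightarrow> homog \<phi> n q \<Longrightarrow> homog \<phi> n (p + q)"
  and homog_diff: "homog \<phi> n p \<Longrightarrow> homog \<phi> n q \<Longrightarrow> homog \<phi> n (p - q)"
  and homog_sum: "(\<And>i. i \<in> I \<Longrightarrow> homog \<phi> n (f i)) \<Longrightarrow> homog \<phi> n (sum f I)"
  unfolding homog_def by (simp_all add: keys_subset_add keys_subset_diff keys_subset_sum)

lemma homog_top_part: "homog \<phi> n p \<Longrightarrow> top_part \<phi> m p = (if m = n then p else 0)"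
  unfolding homog_def top_part_def by (auto intro: part_eq_self part_eq_0)

lemma homog_weight_le: "homog \<phi> n p \<Longrightarrow> weight_le \<phi> n p"
  by (auto simp: homog_def weight_le_def)

lemma homog_mult:
  fixes p q :: "'k::comm_monoid_add \<Rightarrow>\<^sub>0 complex"
  assumes "additive_weight \<phi>" "homog \<phi> a p" "homog \<phi> b q"
  shows "homog \<phi> (a + b) (p * q)"
  using keys_mult[of p q] assms unfolding homog_def additive_weight_def by fastforce

lemma homog_power:
  fixes p :: "'k::comm_monoid_add \<Rightarrow>\<^sub>0 complex"
  assumes "additive_weight \<phi>" "homog \<phi> a p"
  shows "homog \<phi> (int n * a) (p ^ n)"
proof (induction n)
  case 0
  show ?case using additive_weight_0[OF assms(1)] by (simp add: homog_def)
next
  case (Suc n)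
  show ?case using homog_mult[OF assms Suc] by (simp add: algebra_simps)
qed

lemma homog_excess_theta_symb: "homog (excess k) 0 (theta_symb i)"
  by (simp add: theta_symb_def homog_single excess_def)

lemma homog_excess_theta_total_symb: "homog (excess k) 0 theta_total_symb"
  unfolding theta_total_symb_def by (intro homog_sum homog_excess_theta_symb)

lemma homog_excess_x_symb: "homog (excess k) (if i = k then 1 else 0) (x_symb i)"
  by (simp add: x_symb_def homog_single excess_def)

lemma homog_excess_ell_symb: "i \<noteq> k \<Longrightarrow> homog (excess k) 0 (ell_symb i)"
  unfolding ell_symb_def power2_eq_square
  using homog_mult[OF additive_excess homog_excess_theta_symb[of k i] homog_excess_theta_symb[of k i]]
    homog_mult[OF additive_excess homog_excess_x_symb[of k i] homog_mult[OF additive_excess homog_excess_theta_total_symb[of k] homog_excess_theta_total_symb[of k]]]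
  by (intro homog_diff) simp_all

text \<open>
  The degree in a single \<open>x\<^sub>k\<close> isolates the monomial \<open>x\<^sub>k \<xi>\<^sub>k\<close> as leading form of \<open>\<Sum> x\<^sub>j \<xi>\<^sub>j\<close>.
\<close>

lemma theta_total_symb_mult_eq_0:
  fixes p :: "'m::finite symb_poly"
  assumes "theta_total_symb * p = 0"
  shows "p = 0"
proof -
  \<comment> \<open>Any index will do; there is one because types are nonempty.\<close>
  fix k :: 'm
  define \<phi> where "\<phi> \<kappa> = int (fst \<kappa> k)" for \<kappa> :: "'m bimono"
  have \<phi>: "additive_weight \<phi>" by (simp add: additive_weight_def \<phi>_def)
  have theta_symb: "homog \<phi> (if i = k then 1 else 0) (theta_symb i)" for i
    by (simp add: theta_symb_def homog_single \<phi>_def)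
  have "weight_le \<phi> 1 (theta_symb i)" for i
    by (rule weight_le_mono[OF homog_weight_le[OF theta_symb]]) simp
  then have le: "weight_le \<phi> 1 theta_total_symb" unfolding theta_total_symb_def by (intro weight_le_sum)
  have "top_part \<phi> 1 theta_total_symb = (\<Sum>i\<in>UNIV. if i = k then theta_symb k else 0)"
    unfolding theta_total_symb_def top_part_sum by (intro sum.cong refl) (simp add: homog_top_part[OF theta_symb])
  then have "top_part \<phi> 1 theta_total_symb = theta_symb k" by simp
  then show ?thesis
    using nonzero_divisor_top_part[OF \<phi> le _ assms] monomial_mult_eq_0 by (metis theta_symb_def zero_neq_one)
qed

text \<open>
  Multiplication by \<open>L\<^sub>k = (x\<^sub>k \<xi>\<^sub>k)\<^sup>2 - x\<^sub>k S\<^sup>2\<close> spreads the range of the excess: its lowest part is multiplied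
  by \<open>(x\<^sub>k \<xi>\<^sub>k)\<^sup>2\<close> and stays in place, its highest part is multiplied by \<open>x\<^sub>k S\<^sup>2\<close> and moves up by one. So
  the product cannot be concentrated in excess \<open>0\<close>.
\<close>

lemma ell_symb_mult_homog:
  fixes b :: "'m::finite symb_poly"
  assumes "homog (excess k) 0 (ell_symb k * b)"
  shows "b = 0"
proof (rule ccontr)
  assume b: "b \<noteq> 0"
  let ?x = "x_symb k * theta_total_symb ^ 2"
  have y: "homog (excess k) 0 (theta_symb k ^ 2)" and x: "homog (excess k) 1 ?x"
    using homog_mult[OF additive_excess homog_excess_theta_symb[of k k] homog_excess_theta_symb[of k k]]
      homog_mult[OF additive_excess homog_excess_x_symb[of k k] homog_mult[OF additive_excess homog_excess_theta_total_symb[of k] homog_excess_theta_total_symb[of k]]]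
    by (simp_all add: power2_eq_square)
  have neg: "additive_weight (\<lambda>\<kappa>. - excess k \<kappa>)" by (simp add: additive_weight_def excess_def)
  have neg_homog: "homog (\<lambda>\<kappa>. - excess k \<kappa>) (- n) p" if "homog (excess k) n p" for n p
    using that by (auto simp: homog_def)
  obtain n where n: "weight_le (excess k) n b" "top_part (excess k) n b \<noteq> 0" using b by (rule weight_le_attained)
  obtain m where m: "weight_le (\<lambda>\<kappa>. - excess k \<kappa>) m b" "top_part (\<lambda>\<kappa>. - excess k \<kappa>) m b \<noteq> 0"
    using b by (rule weight_le_attained)
  have ny: "homog (\<lambda>\<kappa>. - excess k \<kappa>) 0 (theta_symb k ^ 2)" and nx: "homog (\<lambda>\<kappa>. - excess k \<kappa>) (-1) ?x"
    using neg_homog[OF y] neg_homog[OF x] by simp_all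
  have "weight_le (\<lambda>\<kappa>. - excess k \<kappa>) 0 (ell_symb k)"
    unfolding ell_symb_def by (intro weight_le_diff homog_weight_le ny weight_le_mono[OF homog_weight_le[OF nx]]) simp
  from top_part_mult[OF neg this m(1)]
  have 1: "top_part (\<lambda>\<kappa>. - excess k \<kappa>) m (ell_symb k * b) = theta_symb k ^ 2 * top_part (\<lambda>\<kappa>. - excess k \<kappa>) m b"
    by (simp add: ell_symb_def top_part_diff homog_top_part[OF ny] homog_top_part[OF nx])
  have "theta_symb k ^ 2 * top_part (\<lambda>\<kappa>. - excess k \<kappa>) m b \<noteq> 0"
    using m(2) by (metis monomial_mult_eq_0 theta_symb_power zero_neq_one)
  with 1 homog_top_part[OF neg_homog[OF assms], of m] have "m = 0" by (auto split: if_splits)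
  have "0 \<le> n"
  proof (rule ccontr)
    assume "\<not> 0 \<le> n"
    have "excess k \<kappa> \<le> n" "- excess k \<kappa> \<le> 0" if "\<kappa> \<in> Poly_Mapping.keys b" for \<kappa>
      using n(1) m(1) that \<open>m = 0\<close> by (auto dest: weight_leD)
    then have "\<kappa> \<notin> Poly_Mapping.keys b" for \<kappa> using \<open>\<not> 0 \<le> n\<close> by fastforce
    then have "Poly_Mapping.keys b = {}" by blast
    with b show False by simp
  qed
  have "weight_le (excess k) 1 (ell_symb k)"
    unfolding ell_symb_def by (intro weight_le_diff homog_weight_le x weight_le_mono[OF homog_weight_le[OF y]]) simp
  from top_part_mult[OF additive_excess this n(1)]
  have "- (?x * top_part (excess k) n b) = top_part (excess k) (1 + n) (ell_symb k * b)"
    by (simp add: ell_symb_def top_part_diff homog_top_part[OF x] homog_top_part[OF y])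
  also have "\<dots> = 0" using homog_top_part[OF assms, of "1 + n"] \<open>0 \<le> n\<close> by simp
  finally have "x_symb k * (theta_total_symb * (theta_total_symb * top_part (excess k) n b)) = 0"
    by (simp add: power2_eq_square mult.assoc)
  then have "theta_total_symb * (theta_total_symb * top_part (excess k) n b) = 0"
    unfolding x_symb_def by (rule monomial_mult_eq_0) simp
  with n(2) show False by (auto dest: theta_total_symb_mult_eq_0)
qed

definition x_prod :: "'m::finite symb_poly" where
  "x_prod = Poly_Mapping.single (\<lambda>_. 1, 0) 1"

lemma x_prod_power: "x_prod ^ n = Poly_Mapping.single (\<lambda>_. n, 0) 1"
proof (induction n)
  case 0
  have "(\<lambda>_. 0) = (0 :: 'a \<Rightarrow> nat)" by auto
  then show ?case by (simp flip: zero_prod_def)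
next
  case (Suc n)
  have "(\<lambda>_. 1) + (\<lambda>_. n) = (\<lambda>_::'a. Suc n)" by auto
  then show ?case unfolding power_Suc Suc by (simp only: x_prod_def mult_single add_Pair mult_1_right add_0_right)
qed

lemma x_symb_power: "x_symb i ^ n = Poly_Mapping.single (\<lambda>j. if j = i then n else 0, 0) 1"
proof (induction n)
  case 0
  have "(\<lambda>j. if j = i then 0 else 0) = (0 :: 'a \<Rightarrow> nat)" by auto
  then show ?case by (simp flip: zero_prod_def)
next
  case (Suc n)
  have "unit_exp i + (\<lambda>j. if j = i then n else 0) = (\<lambda>j. if j = i then Suc n else 0)" by auto
  then show ?case
    unfolding power_Suc Suc by (simp only: x_symb_def mult_single add_Pair mult_1_right add_0_right)
qed

lemma power_diff_remainder:
  fixes u v :: "'r::comm_ring_1"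
  shows "\<exists>w. (u - v) ^ n = u ^ n + v * w"
proof
  let ?q = "\<Sum>i<n. u ^ (n - Suc i) * (u - v) ^ i"
  have "(u - v) ^ n - u ^ n = - (v * ?q)"
    using power_diff_sumr2[of "u - v" n u] by simp
  then show "(u - v) ^ n = u ^ n + v * - ?q"
    by (simp add: diff_eq_eq)
qed

text \<open>
  Where \<open>S = \<Sum> x\<^sub>j \<xi>\<^sub>j\<close> is invertible, \<open>L\<^sub>k\<close> is as good as a coordinate function: in the variables \<open>x\<^sub>j\<close> and
  \<open>y\<^sub>j = x\<^sub>j \<xi>\<^sub>j\<close> the equation \<open>x\<^sub>k S\<^sup>2 = y\<^sub>k\<^sup>2 - L\<^sub>k\<close> eliminates \<open>x\<^sub>k\<close>. The remainders are the polynomials in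
  which \<open>x\<^sub>k\<close> occurs through \<open>y\<^sub>k\<close> only, that is, those of excess \<open>0\<close>. The multiplier needs the product of the \<open>x\<^sub>j\<close>
  in order to absorb \<open>\<xi>\<^sub>k\<close> into \<open>y\<^sub>k\<close>, and then up to \<open>2 n\<close> factors \<open>S\<^sup>2\<close> in order to eliminate the remaining
  powers of \<open>x\<^sub>k\<close>, whence the exponent \<open>4\<close>.
\<close>

lemma division_by_ell_symb:
  fixes g :: "'m::finite symb_poly"
  shows "\<exists>n0. \<forall>n\<ge>n0. \<exists>a b. homog (excess k) 0 a \<and> (theta_total_symb ^ 4 * x_prod) ^ n * g = a + ell_symb k * b"
proof (induction g rule: symb_poly_induct)
  case (single \<kappa> c)
  obtain \<alpha> \<beta> where \<kappa>: "\<kappa> = (\<alpha>, \<beta>)" by (metis surj_pair)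
  show ?case
  proof (intro exI[of _ "\<alpha> k + \<beta> k"] allI impI)
    fix n assume n: "\<alpha> k + \<beta> k \<le> n"
    \<comment> \<open>The number of surplus factors \<open>x\<^sub>k\<close> once every \<open>\<xi>\<^sub>k\<close> has been paired with one.\<close>
    define m where "m = n + \<alpha> k - \<beta> k"
    define \<kappa>' where "\<kappa>' = (((\<lambda>_. n) + \<alpha>)(k := \<beta> k), \<beta>)"
    have m: "2 * m \<le> 4 * n" using n by (simp add: m_def)
    have "(\<lambda>_. n) + \<alpha> = (\<lambda>j. if j = k then m else 0) + ((\<lambda>_. n) + \<alpha>)(k := \<beta> k)"
      using n by (auto simp: m_def fun_eq_iff)
    then have X: "x_prod ^ n * Poly_Mapping.single \<kappa> c = x_symb k ^ m * Poly_Mapping.single \<kappa>' c"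
      unfolding x_prod_power x_symb_power \<kappa> \<kappa>'_def mult_single add_Pair by simp
    obtain w where w: "(theta_symb k ^ 2 - ell_symb k) ^ m = (theta_symb k ^ 2) ^ m + ell_symb k * w"
      using power_diff_remainder by blast
    have x: "x_symb k * theta_total_symb ^ 2 = theta_symb k ^ 2 - ell_symb k" by (simp add: ell_symb_def)
    let ?r = "theta_total_symb ^ (4 * n - 2 * m) * Poly_Mapping.single \<kappa>' c"
    have "theta_total_symb ^ (4 * n) = theta_total_symb ^ (2 * m) * (theta_total_symb ^ (4 * n - 2 * m) :: 'm symb_poly)"
      using m by (simp flip: power_add)
    then have "(theta_total_symb ^ 4 * x_prod) ^ n * Poly_Mapping.single \<kappa> c =
        (theta_total_symb ^ (2 * m) * theta_total_symb ^ (4 * n - 2 * m)) * (x_prod ^ n * Poly_Mapping.single \<kappa> c)"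
      by (simp add: power_mult_distrib mult.assoc flip: power_mult)
    also have "\<dots> = (x_symb k * theta_total_symb ^ 2) ^ m * ?r"
      unfolding X by (simp add: power_mult_distrib mult_ac flip: power_mult)
    also have "\<dots> = (theta_symb k ^ 2) ^ m * ?r + ell_symb k * (w * ?r)"
      unfolding x w by (simp add: distrib_right mult.assoc)
    finally have eq: "(theta_total_symb ^ 4 * x_prod) ^ n * Poly_Mapping.single \<kappa> c = (theta_symb k ^ 2) ^ m * ?r + ell_symb k * (w * ?r)" .
    have "homog (excess k) 0 (Poly_Mapping.single \<kappa>' c)" by (simp add: homog_single excess_def \<kappa>'_def)
    moreover have "homog (excess k) 0 (theta_total_symb ^ (4 * n - 2 * m))" "homog (excess k) 0 ((theta_symb k ^ 2) ^ m)"
      using homog_power[OF additive_excess homog_excess_theta_total_symb, of k "4 * n - 2 * m"]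
        homog_power[OF additive_excess homog_excess_theta_symb, of k "2 * m" k] by (simp_all add: power_mult)
    ultimately have "homog (excess k) 0 ((theta_symb k ^ 2) ^ m * ?r)"
      using homog_mult[OF additive_excess, of k 0 _ 0] by simp
    with eq show "\<exists>a b. homog (excess k) 0 a \<and> (theta_total_symb ^ 4 * x_prod) ^ n * Poly_Mapping.single \<kappa> c = a + ell_symb k * b"
      by blast
  qed
next
  case (add p q)
  then obtain n1 n2 where
    n1: "\<And>n. n1 \<le> n \<Longrightarrow> \<exists>a b. homog (excess k) 0 a \<and> (theta_total_symb ^ 4 * x_prod) ^ n * p = a + ell_symb k * b" and
    n2: "\<And>n. n2 \<le> n \<Longrightarrow> \<exists>a b. homog (excess k) 0 a \<and> (theta_total_symb ^ 4 * x_prod) ^ n * q = a + ell_symb k * b"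
    by blast
  show ?case
  proof (intro exI[of _ "max n1 n2"] allI impI)
    fix n assume "max n1 n2 \<le> n"
    then obtain a b a' b' where
      "homog (excess k) 0 a" "(theta_total_symb ^ 4 * x_prod) ^ n * p = a + ell_symb k * b"
      "homog (excess k) 0 a'" "(theta_total_symb ^ 4 * x_prod) ^ n * q = a' + ell_symb k * b'"
      using n1[of n] n2[of n] by auto
    then have "homog (excess k) 0 (a + a')" "(theta_total_symb ^ 4 * x_prod) ^ n * (p + q) = (a + a') + ell_symb k * (b + b')"
      by (simp_all add: homog_add distrib_left)
    then show "\<exists>a b. homog (excess k) 0 a \<and> (theta_total_symb ^ 4 * x_prod) ^ n * (p + q) = a + ell_symb k * b" by blast
  qed
qed

lemma symb_combination_generic:
  fixes p :: "'m::finite weyl"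
  assumes p: "p \<in> hypergeometric_ideal a b c" "order_le d p"
  shows "\<exists>n g. (theta_total_symb ^ 4 * x_prod) ^ n * symb d p = (\<Sum>i\<in>UNIV. g i * ell_symb i)"
proof -
  obtain q where q: "p = (\<Sum>i\<in>UNIV. q i * ell a b c i)"
    using p(1) by (rule hypergeometric_ideal_combination)
  have "homog order_wt 1 (theta_total_symb :: 'm symb_poly)"
    unfolding theta_total_symb_def by (intro homog_sum) (simp add: theta_symb_def homog_single order_wt_def)
  then have "homog order_wt 4 (theta_total_symb ^ 4 :: 'm symb_poly)"
    using homog_power[OF additive_order_wt, of 1 theta_total_symb 4] by simp
  moreover have "homog order_wt 0 (x_prod :: 'm symb_poly)"
    by (simp add: x_prod_def homog_single order_wt_def)
  ultimately have h: "homog order_wt 4 (theta_total_symb ^ 4 * x_prod :: 'm symb_poly)"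
    using homog_mult[OF additive_order_wt, of 4 "theta_total_symb ^ 4" 0 x_prod] by simp
  have "\<exists>n g. Poly_Mapping.keys ((theta_total_symb ^ 4 * x_prod) ^ n * symb d p - (\<Sum>i\<in>UNIV. g i * ell_symb i)) \<subseteq> {}"
  proof (rule descent[where D = "ell a b c" and s = 2 and H = "of_normal_form (theta_total_symb ^ 4 * x_prod)" and k = 4 and L = ell_symb])
    fix g :: "'m \<Rightarrow> 'm symb_poly"
    assume "Poly_Mapping.keys (\<Sum>i\<in>UNIV. g i * ell_symb i) \<subseteq> {}"
    then have z: "(\<Sum>i\<in>UNIV. g i * ell_symb i) = 0" by simp
    have "\<exists>n t. \<forall>i\<in>UNIV. (theta_total_symb ^ 4 * x_prod) ^ n * g i = (\<Sum>j\<in>UNIV. (t i j - t j i) * ell_symb j)"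
    proof (rule koszul_syzygies[where N = "\<lambda>k. {p. homog (excess k) 0 p}"])
      fix i k :: 'm and p :: "'m symb_poly"
      assume "i \<noteq> k" "p \<in> {p. homog (excess k) 0 p}"
      then show "p * ell_symb i \<in> {p. homog (excess k) 0 p}"
        using homog_mult[OF additive_excess _ homog_excess_ell_symb, of k 0 p i] by simp
    next
      fix k and p :: "'m symb_poly"
      show "\<exists>n0. \<forall>n\<ge>n0. \<exists>a b. a \<in> {p. homog (excess k) 0 p} \<and> (theta_total_symb ^ 4 * x_prod) ^ n * p = a + ell_symb k * b"
        using division_by_ell_symb[of k p] by simp
    qed (use z in \<open>auto simp: homog_add homog_0 dest: ell_symb_mult_homog\<close>)
    then show "\<exists>n t. \<forall>i. Poly_Mapping.keys ((theta_total_symb ^ 4 * x_prod) ^ n * g i - (\<Sum>j\<in>UNIV. (t i j - t j i) * ell_symb j)) \<subseteq> {}"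
      by auto
  next
    show "order_le 4 (of_normal_form (theta_total_symb ^ 4 * x_prod :: 'm symb_poly))"
      by (simp add: order_le_def of_normal_form_inverse homog_weight_le[OF h])
    show "symb 4 (of_normal_form (theta_total_symb ^ 4 * x_prod)) = (theta_total_symb ^ 4 * x_prod :: 'm symb_poly)"
      by (simp add: symb_def of_normal_form_inverse homog_top_part[OF h])
  qed (use q p(2) in \<open>auto intro: ell_commute order_le_ell symb_ell simp: normal_form_eq_0_iff\<close>)
  then show ?thesis by auto
qed

section \<open>Evaluation of polynomials\<close>

text \<open>
  Evaluation with an arbitrary function on exponents in place of the monomial functions. It is a ring
  homomorphism whenever that function is a character; this covers both \<^const>\<open>symb_eval\<close> and
  \<^const>\<open>poly_eval\<close>.
\<close>

definition mono_eval :: "('k \<Rightarrow> complex) \<Rightarrow> ('k \<Rightarrow>\<^sub>0 complex) \<Rightarrow> complex" where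
  "mono_eval \<eta> p = (\<Sum>k\<in>Poly_Mapping.keys p. Poly_Mapping.lookup p k * \<eta> k)"

lemma mono_eval_superset:
  "finite A \<Longrightarrow> Poly_Mapping.keys p \<subseteq> A \<Longrightarrow> mono_eval \<eta> p = (\<Sum>k\<in>A. Poly_Mapping.lookup p k * \<eta> k)"
  unfolding mono_eval_def by (intro sum.mono_neutral_left) (auto simp: in_keys_iff)

lemma mono_eval_single [simp]: "mono_eval \<eta> (Poly_Mapping.single k c) = c * \<eta> k"
  by (subst mono_eval_superset[of "{k}"]) auto

lemma mono_eval_0 [simp]: "mono_eval \<eta> 0 = 0"
  by (simp add: mono_eval_def)

lemma mono_eval_add: "mono_eval \<eta> (p + q) = mono_eval \<eta> p + mono_eval \<eta> q"
proof -
  let ?A = "Poly_Mapping.keys p \<union> Poly_Mapping.keys q"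
  show ?thesis
    by (simp add: mono_eval_superset[of ?A] keys_add lookup_add distrib_right sum.distrib)
qed

lemma mono_eval_diff: "mono_eval \<eta> (p - q) = mono_eval \<eta> p - mono_eval \<eta> q"
  using mono_eval_add[of \<eta> "p - q" q] by simp

lemma mono_eval_sum: "mono_eval \<eta> (sum f A) = (\<Sum>a\<in>A. mono_eval \<eta> (f a))"
  by (induction A rule: infinite_finite_induct) (simp_all add: mono_eval_add)

lemma mono_eval_mult:
  fixes p q :: "'k::comm_monoid_add \<Rightarrow>\<^sub>0 complex"
  assumes "\<And>k l. \<eta> (k + l) = \<eta> k * \<eta> l"
  shows "mono_eval \<eta> (p * q) = mono_eval \<eta> p * mono_eval \<eta> q"
proof (induction p rule: symb_poly_induct)
  case (single k c)
  show ?case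
    by (induction q rule: symb_poly_induct)
      (simp_all add: mult_single assms mono_eval_add distrib_left)
qed (simp add: distrib_right mono_eval_add)

lemma mono_eval_power:
  fixes p :: "'k::comm_monoid_add \<Rightarrow>\<^sub>0 complex"
  assumes "\<And>k l. \<eta> (k + l) = \<eta> k * \<eta> l" "\<eta> 0 = 1"
  shows "mono_eval \<eta> (p ^ n) = mono_eval \<eta> p ^ n"
proof (induction n)
  case 0
  have "mono_eval \<eta> (Poly_Mapping.single 0 1) = 1" unfolding mono_eval_single by (simp add: assms)
  then show ?case by simp
next
  case (Suc n)
  then show ?case by (simp add: mono_eval_mult assms)
qed

lemma mono_eval_prod:
  fixes f :: "'i \<Rightarrow> 'k::comm_monoid_add \<Rightarrow>\<^sub>0 complex"
  assumes "\<And>k l. \<eta> (k + l) = \<eta> k * \<eta> l" "\<eta> 0 = 1"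
  shows "mono_eval \<eta> (prod f A) = (\<Prod>a\<in>A. mono_eval \<eta> (f a))"
proof -
  have "mono_eval \<eta> 1 = 1" using mono_eval_power[OF assms, of 0 0] by simp
  then show ?thesis
    by (induction A rule: infinite_finite_induct) (simp_all add: mono_eval_mult assms)
qed

definition bimonomial :: "complex ^ 'm::finite \<Rightarrow> complex ^ 'm \<Rightarrow> 'm bimono \<Rightarrow> complex" where
  "bimonomial x \<xi> \<kappa> = (\<Prod>i\<in>UNIV. x $ i ^ fst \<kappa> i) * (\<Prod>i\<in>UNIV. \<xi> $ i ^ snd \<kappa> i)"

lemma bimonomial_add: "bimonomial x \<xi> (\<kappa> + \<kappa>') = bimonomial x \<xi> \<kappa> * bimonomial x \<xi> \<kappa>'"
  by (simp add: bimonomial_def power_add prod.distrib)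

lemma bimonomial_0: "bimonomial x \<xi> 0 = 1"
  by (simp add: bimonomial_def)

lemma symb_eval_eq: "symb_eval f (x, \<xi>) = mono_eval (bimonomial x \<xi>) f"
  by (simp add: symb_eval_def mono_eval_def bimonomial_def case_prod_beta mult.assoc)

lemma prod_power_unit: "(\<Prod>j\<in>UNIV. x j ^ (if j = i then n else 0)) = (x i :: complex) ^ n"
  for i :: "'m::finite"
proof -
  have "(\<Prod>j\<in>UNIV. x j ^ (if j = i then n else 0)) = (\<Prod>j\<in>UNIV. if j = i then x i ^ n else 1)"
    by (intro prod.cong) auto
  then show ?thesis by simp
qed

lemma eval_x_symb: "mono_eval (bimonomial x \<xi>) (x_symb i) = x $ i"
  and eval_theta_symb: "mono_eval (bimonomial x \<xi>) (theta_symb i) = x $ i * \<xi> $ i"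
  and eval_x_prod: "mono_eval (bimonomial x \<xi>) x_prod = (\<Prod>i\<in>UNIV. x $ i)"
  using prod_power_unit[of "\<lambda>i. x $ i" i 1] prod_power_unit[of "\<lambda>i. \<xi> $ i" i 1]
  by (simp_all only: x_symb_def theta_symb_def x_prod_def mono_eval_single bimonomial_def fst_conv snd_conv
      zero_fun_apply power_0 power_one_right prod.neutral_const mult_1_right mult_1_left)

lemma eval_theta_total_symb: "mono_eval (bimonomial x \<xi>) theta_total_symb = (\<Sum>i\<in>UNIV. x $ i * \<xi> $ i)"
  by (simp add: theta_total_symb_def mono_eval_sum eval_theta_symb)

lemmas eval_hom = mono_eval_add mono_eval_diff mono_eval_sum
  mono_eval_mult[OF bimonomial_add] mono_eval_power[OF bimonomial_add bimonomial_0]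

lemma eval_ell_symb:
  "mono_eval (bimonomial x \<xi>) (ell_symb i) = (x $ i * \<xi> $ i) ^ 2 - x $ i * (\<Sum>j\<in>UNIV. x $ j * \<xi> $ j) ^ 2"
  by (simp add: ell_symb_def eval_hom eval_x_symb eval_theta_symb eval_theta_total_symb)

section \<open>Points of the characteristic variety\<close>

lemma principal_symbol_eq: "principal_symbol p = symb (int (weyl_order p)) p"
  and order_le_weyl_order: "order_le (int (weyl_order p)) p"
proof -
  let ?K = "{(\<alpha>, \<beta>) \<in> Poly_Mapping.keys (normal_form p). exp_degree \<beta> = weyl_order p}"
  have "finite ?K" by (rule finite_subset[of _ "Poly_Mapping.keys (normal_form p)"]) auto
  then show "principal_symbol p = symb (int (weyl_order p)) p"
    unfolding principal_symbol_def symb_def top_part_def case_prod_eta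
    by (intro poly_mapping_eqI)
      (auto simp: lookup_sum lookup_single when_def in_keys_iff order_wt_def sum.delta split: prod.splits)
  show "order_le (int (weyl_order p)) p"
    unfolding order_le_def weyl_order_def by (rule weight_leI) (force simp: order_wt_def intro: Max_ge)
qed

lemma weyl_order_unique:
  assumes "order_le (int n) p" "symb (int n) p \<noteq> 0"
  shows "weyl_order p = n"
proof -
  have "weyl_order p \<le> n"
  proof -
    have "Poly_Mapping.keys (normal_form p) \<noteq> {}"
      using assms(2) by (auto simp: symb_def)
    then have "weyl_order p \<in> (\<lambda>(\<alpha>, \<beta>). exp_degree \<beta>) ` Poly_Mapping.keys (normal_form p)"
      unfolding weyl_order_def by (intro Max_in) auto
    then obtain \<kappa> where "\<kappa> \<in> Poly_Mapping.keys (normal_form p)" "weyl_order p = exp_degree (snd \<kappa>)"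
      by auto
    with assms(1) show ?thesis by (auto simp: order_le_def order_wt_def dest!: weight_leD)
  qed
  moreover have "\<not> weyl_order p < n"
    using symb_eq_0[OF order_le_weyl_order[of p], of "int n"] assms(2) by auto
  ultimately show ?thesis by simp
qed

lemma char_variety_iff:
  "(x, \<xi>) \<in> char_variety I \<longleftrightarrow> (\<forall>p\<in>I - {0}. mono_eval (bimonomial x \<xi>) (principal_symbol p) = 0)"
proof
  assume "(x, \<xi>) \<in> char_variety I"
  then show "\<forall>p\<in>I - {0}. mono_eval (bimonomial x \<xi>) (principal_symbol p) = 0"
    using hull_subset[of "principal_symbol ` (I - {0})" left_ideal]
    unfolding char_variety_def char_ideal_def left_ideal_generated_def by (force simp: symb_eval_eq)
next
  assume *: "\<forall>p\<in>I - {0}. mono_eval (bimonomial x \<xi>) (principal_symbol p) = 0"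
  have "left_ideal {f. mono_eval (bimonomial x \<xi>) f = 0}"
    by (simp add: left_ideal_def eval_hom)
  then have "char_ideal I \<subseteq> {f. mono_eval (bimonomial x \<xi>) f = 0}"
    unfolding char_ideal_def left_ideal_generated_def using * by (intro hull_minimal) auto
  then show "(x, \<xi>) \<in> char_variety I" by (auto simp: char_variety_def symb_eval_eq)
qed

lemma ell_symb_nonzero: "ell_symb i \<noteq> 0"
proof
  assume "ell_symb i = 0"
  then have "Poly_Mapping.keys (theta_symb i ^ 2) = {}" using top_part_V_wt_ell_symb[of i] by simp
  then show False unfolding theta_symb_power by simp
qed

lemma ell_in_ideal: "ell a b c i \<in> hypergeometric_ideal a b c"
  unfolding hypergeometric_ideal_def left_ideal_generated_def
  by (rule subsetD[OF hull_subset rangeI])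

lemma ell_nonzero: "ell a b c i \<noteq> 0"
proof
  assume "ell a b c i = 0"
  then have "ell_symb i = 0" using symb_ell[of a b c i] by simp
  then show False by (simp add: ell_symb_nonzero)
qed

lemma principal_symbol_ell: "principal_symbol (ell a b c i) = ell_symb i"
proof -
  have "weyl_order (ell a b c i) = 2"
    using weyl_order_unique[of 2 "ell a b c i"] order_le_ell[of a b c i] ell_symb_nonzero[of i]
    unfolding of_nat_numeral symb_ell by blast
  then show ?thesis by (simp add: principal_symbol_eq symb_ell)
qed

text \<open>
  One inclusion for the characteristic variety: the generators \<^term>\<open>ell a b c i\<close> themselves belong to the ideal.
\<close>

lemma char_variety_ell:
  assumes "(x, \<xi>) \<in> char_variety (hypergeometric_ideal a b c)"
  shows "(x $ i * \<xi> $ i) ^ 2 = x $ i * (\<Sum>j\<in>UNIV. x $ j * \<xi> $ j) ^ 2"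
proof -
  have "mono_eval (bimonomial x \<xi>) (principal_symbol (ell a b c i)) = 0"
    using assms ell_in_ideal[of a b c i] ell_nonzero[of a b c i] unfolding char_variety_iff by blast
  then show ?thesis by (simp add: principal_symbol_ell eval_ell_symb)
qed

text \<open>
  If some coordinate of \<open>x\<close> vanishes, these points include some with \<open>\<xi> \<noteq> 0\<close>, for instance a unit vector.
\<close>

lemma char_variety_thetas_vanish:
  assumes "\<And>i. x $ i * \<xi> $ i = 0"
  shows "(x, \<xi>) \<in> char_variety (hypergeometric_ideal a b c)"
  unfolding char_variety_iff
proof
  fix p assume "p \<in> hypergeometric_ideal a b c - {0}"
  then have d: "in_theta_ideal (principal_symbol p)"
    unfolding principal_symbol_eq by (intro symb_in_theta_ideal[OF _ order_le_weyl_order]) auto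
  have "bimonomial x \<xi> \<kappa> = 0" if "\<kappa> \<in> Poly_Mapping.keys (principal_symbol p)" for \<kappa>
  proof -
    from d that obtain j where "1 \<le> fst \<kappa> j" "1 \<le> snd \<kappa> j" unfolding in_theta_ideal_def by blast
    with assms[of j] have "x $ j ^ fst \<kappa> j = 0 \<or> \<xi> $ j ^ snd \<kappa> j = 0" by auto
    then show ?thesis unfolding bimonomial_def by (auto simp: prod_zero_iff simp del: power_eq_0_iff)
  qed
  then show "mono_eval (bimonomial x \<xi>) (principal_symbol p) = 0" by (simp add: mono_eval_def)
qed

text \<open>
  Here the multiplier of \<open>symb_combination_generic\<close> does not vanish, so it can be cancelled.
\<close>

lemma char_variety_generic:
  assumes "\<And>i. x $ i \<noteq> 0" "(\<Sum>j\<in>UNIV. x $ j * \<xi> $ j) \<noteq> 0"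
    and "\<And>i. (x $ i * \<xi> $ i) ^ 2 = x $ i * (\<Sum>j\<in>UNIV. x $ j * \<xi> $ j) ^ 2"
  shows "(x, \<xi>) \<in> char_variety (hypergeometric_ideal a b c)"
  unfolding char_variety_iff
proof
  fix p assume "p \<in> hypergeometric_ideal a b c - {0}"
  then obtain n g where "(theta_total_symb ^ 4 * x_prod) ^ n * principal_symbol p = (\<Sum>i\<in>UNIV. g i * ell_symb i)"
    unfolding principal_symbol_eq using symb_combination_generic[OF _ order_le_weyl_order] by blast
  then have "mono_eval (bimonomial x \<xi>) ((theta_total_symb ^ 4 * x_prod) ^ n * principal_symbol p) =
      mono_eval (bimonomial x \<xi>) (\<Sum>i\<in>UNIV. g i * ell_symb i)" by simp
  then show "mono_eval (bimonomial x \<xi>) (principal_symbol p) = 0"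
    using assms by (simp add: eval_hom eval_ell_symb eval_theta_total_symb eval_x_prod)
qed

section \<open>The sign product is a polynomial in the squares\<close>

text \<open>
  Averaging over all sign changes does not change an even polynomial, but kills every monomial with an odd
  exponent. So the monomials with even exponents alone represent the same function.
\<close>

lemma even_function_of_squares:
  fixes Q :: "('m::finite \<Rightarrow> nat) \<Rightarrow>\<^sub>0 complex"
  defines "S \<equiv> {\<epsilon> :: 'm \<Rightarrow> complex. \<forall>i. \<epsilon> i \<in> {-1, 1}}"
  assumes even: "\<And>\<epsilon> r. \<epsilon> \<in> S \<Longrightarrow> poly_eval Q (\<chi> i. \<epsilon> i * r $ i) = poly_eval Q r"
  shows "\<exists>P. \<forall>x r. (\<forall>i. (r $ i)\<^sup>2 = x $ i) \<longrightarrow> poly_eval P x = poly_eval Q r"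
proof -
  let ?K = "{\<alpha> \<in> Poly_Mapping.keys Q. \<forall>i. even (\<alpha> i)}"
  define P where "P = (\<Sum>\<alpha>\<in>?K. Poly_Mapping.single (\<lambda>i. \<alpha> i div 2) (Poly_Mapping.lookup Q \<alpha>))"
  have poly_eval: "poly_eval f x = mono_eval (\<lambda>\<alpha>. \<Prod>i\<in>UNIV. x $ i ^ \<alpha> i) f" for f and x :: "complex ^ 'm"
    by (simp add: poly_eval_def mono_eval_def)
  have S: "S = PiE UNIV (\<lambda>_. {-1, 1})" by (auto simp: S_def PiE_def Pi_def)
  have avg: "(\<Sum>\<epsilon>\<in>S. \<Prod>i\<in>UNIV. \<epsilon> i ^ \<alpha> i) = (if \<forall>i. even (\<alpha> i) then of_nat (card S) else 0)" for \<alpha> :: "'m \<Rightarrow> nat"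
  proof -
    have "(\<Sum>\<epsilon>\<in>S. \<Prod>i\<in>UNIV. \<epsilon> i ^ \<alpha> i) = (\<Prod>i\<in>UNIV. \<Sum>e\<in>{-1, 1 :: complex}. e ^ \<alpha> i)"
      unfolding S by (rule prod_sum_PiE[symmetric]) auto
    also have "\<dots> = (\<Prod>i\<in>UNIV. if even (\<alpha> i) then 2 else 0)"
      by (intro prod.cong refl) simp
    also have "\<dots> = (if \<forall>i. even (\<alpha> i) then 2 ^ CARD('m) else 0)"
      by (auto simp: prod_zero_iff)
    also have "card S = 2 ^ CARD('m)" unfolding S by (simp add: card_PiE numeral_2_eq_2)
    ultimately show ?thesis by simp
  qed
  have card: "card S \<noteq> 0" unfolding S by (simp add: card_PiE)
  have "poly_eval P x = poly_eval Q r" if x: "\<forall>i. (r $ i)\<^sup>2 = x $ i" for x r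
  proof -
    have "of_nat (card S) * poly_eval Q r = (\<Sum>\<epsilon>\<in>S. poly_eval Q (\<chi> i. \<epsilon> i * r $ i))"
      by (simp add: even)
    also have "\<dots> = (\<Sum>\<alpha>\<in>Poly_Mapping.keys Q. Poly_Mapping.lookup Q \<alpha> * (\<Prod>i\<in>UNIV. r $ i ^ \<alpha> i) *
        (\<Sum>\<epsilon>\<in>S. \<Prod>i\<in>UNIV. \<epsilon> i ^ \<alpha> i))"
      unfolding poly_eval_def
      by (subst sum.swap) (simp add: power_mult_distrib prod.distrib sum_distrib_left mult_ac)
    also have "\<dots> = (\<Sum>\<alpha>\<in>Poly_Mapping.keys Q. if \<forall>i. even (\<alpha> i) then of_nat (card S) *
        (Poly_Mapping.lookup Q \<alpha> * (\<Prod>i\<in>UNIV. r $ i ^ \<alpha> i)) else 0)"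
      unfolding avg by (intro sum.cong) auto
    also have "\<dots> = of_nat (card S) * (\<Sum>\<alpha>\<in>?K. Poly_Mapping.lookup Q \<alpha> * (\<Prod>i\<in>UNIV. r $ i ^ \<alpha> i))"
      unfolding sum_distrib_left by (rule sum.inter_filter[symmetric]) simp
    finally have "poly_eval Q r = (\<Sum>\<alpha>\<in>?K. Poly_Mapping.lookup Q \<alpha> * (\<Prod>i\<in>UNIV. r $ i ^ \<alpha> i))"
      using card by simp
    also have "\<dots> = (\<Sum>\<alpha>\<in>?K. Poly_Mapping.lookup Q \<alpha> * (\<Prod>i\<in>UNIV. x $ i ^ (\<alpha> i div 2)))"
    proof (intro sum.cong refl)
      fix \<alpha> assume "\<alpha> \<in> ?K"
      then have "r $ i ^ \<alpha> i = x $ i ^ (\<alpha> i div 2)" for i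
        using x by (metis (mono_tags, lifting) dvd_mult_div_cancel mem_Collect_eq power_mult)
      then show "Poly_Mapping.lookup Q \<alpha> * (\<Prod>i\<in>UNIV. r $ i ^ \<alpha> i) =
          Poly_Mapping.lookup Q \<alpha> * (\<Prod>i\<in>UNIV. x $ i ^ (\<alpha> i div 2))" by simp
    qed
    also have "\<dots> = poly_eval P x" unfolding poly_eval P_def by (simp add: mono_eval_sum)
    finally show ?thesis by simp
  qed
  then show ?thesis by blast
qed

text \<open>
  Changing the signs of the \<open>r\<^sub>i\<close> only permutes the factors of the product over all sign vectors.
\<close>

lemma sing_product_polynomial:
  "\<exists>P :: ('m::finite \<Rightarrow> nat) \<Rightarrow>\<^sub>0 complex.
     \<forall>x r. (\<forall>i. (r $ i)\<^sup>2 = x $ i) \<longrightarrow> poly_eval P x = sing_product x r"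
proof -
  define S where "S = {\<epsilon> :: 'm \<Rightarrow> complex. \<forall>i. \<epsilon> i \<in> {-1, 1}}"
  define \<mu> where "\<mu> x \<alpha> = (\<Prod>i\<in>UNIV. x $ i ^ \<alpha> i)" for x :: "complex ^ 'm" and \<alpha>
  have \<mu>: "\<mu> x (\<alpha> + \<beta>) = \<mu> x \<alpha> * \<mu> x \<beta>" "\<mu> x 0 = 1" for x \<alpha> \<beta>
    by (simp_all add: \<mu>_def power_add prod.distrib)
  have poly_eval: "poly_eval f x = mono_eval (\<mu> x) f" for f x
    by (simp add: poly_eval_def mono_eval_def \<mu>_def)
  define Q where "Q = (\<Prod>\<epsilon>\<in>S. 1 + (\<Sum>i\<in>UNIV. Poly_Mapping.single (unit_exp i) (\<epsilon> i)))"
  have one: "mono_eval (\<mu> r) 1 = 1" for r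
    using mono_eval_power[of "\<mu> r", OF \<mu>, of 0 0] by simp
  have unit: "\<mu> r (unit_exp i) = r $ i" for r i
    unfolding \<mu>_def using prod_power_unit[of "\<lambda>i. r $ i" i 1] by simp
  have Q: "poly_eval Q r = (\<Prod>\<epsilon>\<in>S. 1 + (\<Sum>i\<in>UNIV. \<epsilon> i * r $ i))" for r
    unfolding Q_def poly_eval mono_eval_prod[of "\<mu> r", OF \<mu>] by (simp add: mono_eval_add mono_eval_sum one unit)
  have "poly_eval Q (\<chi> i. \<delta> i * r $ i) = poly_eval Q r" if \<delta>: "\<delta> \<in> S" for \<delta> r
  proof -
    have sq: "\<delta> i * \<delta> i = 1" for i using \<delta> by (auto simp: S_def dest: spec[of _ i])
    show ?thesis
      unfolding Q
    proof (rule prod.reindex_bij_witness[of _ "\<lambda>\<epsilon> i. \<epsilon> i * \<delta> i" "\<lambda>\<epsilon> i. \<epsilon> i * \<delta> i"])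
      fix \<epsilon> assume "\<epsilon> \<in> S"
      then have "\<epsilon> i * \<delta> i \<in> {-1, 1}" for i
        using \<delta> by (auto simp: S_def dest!: spec[of _ i])
      then show "(\<lambda>i. \<epsilon> i * \<delta> i) \<in> S" by (simp add: S_def)
      then show "(\<lambda>i. \<epsilon> i * \<delta> i) \<in> S" .
    qed (simp_all add: mult.assoc sq)
  qed
  then have "\<exists>P. \<forall>x r. (\<forall>i. (r $ i)\<^sup>2 = x $ i) \<longrightarrow> poly_eval P x = poly_eval Q r"
    unfolding S_def by (rule even_function_of_squares)
  then obtain P where P: "\<And>x r. (\<forall>i. (r $ i)\<^sup>2 = x $ i) \<Longrightarrow> poly_eval P x = poly_eval Q r" by blast
  have "poly_eval (Poly_Mapping.single (\<lambda>_. 1) 1 * P) x = sing_product x r" if "\<forall>i. (r $ i)\<^sup>2 = x $ i" for x r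
    unfolding poly_eval mono_eval_mult[of "\<mu> x", OF \<mu>(1)]
    by (simp add: P[OF that] Q sing_product_def S_def \<mu>_def flip: poly_eval)
  then show ?thesis by blast
qed

section \<open>The singular locus\<close>

theorem theorem4p3:
  fixes a b :: complex and c :: "complex ^ 'm::finite"
  shows "sing_locus (hypergeometric_ideal a b c) =
           {x. sing_product x (\<chi> i. csqrt (x $ i)) = 0} \<and>
         (\<exists>P :: ('m \<Rightarrow> nat) \<Rightarrow>\<^sub>0 complex.
            \<forall>x r. (\<forall>i. (r $ i)\<^sup>2 = x $ i) \<longrightarrow> poly_eval P x = sing_product x r)"
proof
  let ?I = "hypergeometric_ideal a b c"
  show "sing_locus ?I = {x. sing_product x (\<chi> i. csqrt (x $ i)) = 0}"
  proof (intro set_eqI iffI)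
    fix x assume "x \<in> sing_locus ?I"
    then obtain \<xi> where \<xi>: "(x, \<xi>) \<in> char_variety ?I" "\<exists>i. \<xi> $ i \<noteq> 0"
      unfolding sing_locus_def by force
    \<comment> \<open>If no \<open>x\<^sub>i\<close> vanishes, then \<open>S \<noteq> 0\<close>, and \<open>- x\<^sub>i \<xi>\<^sub>i / S\<close> is a square root of \<open>x\<^sub>i\<close>; these square roots sum up to \<open>-1\<close>.\<close>
    define S where "S = (\<Sum>j\<in>UNIV. x $ j * \<xi> $ j)"
    have y: "(x $ i * \<xi> $ i) ^ 2 = x $ i * S ^ 2" for i
      unfolding S_def by (rule char_variety_ell[OF \<xi>(1)])
    show "x \<in> {x. sing_product x (\<chi> i. csqrt (x $ i)) = 0}"
    proof (cases "\<exists>i. x $ i = 0")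
      case True
      then show ?thesis by (auto simp: sing_product_def prod_zero_iff)
    next
      case False
      obtain k where "\<xi> $ k \<noteq> 0" using \<xi>(2) by blast
      then have S: "S \<noteq> 0" using y[of k] False by auto
      define \<epsilon> where "\<epsilon> i = - (x $ i * \<xi> $ i / S) / csqrt (x $ i)" for i
      have r: "csqrt (x $ i) \<noteq> 0" for i using False by simp
      have "\<epsilon> i ^ 2 = 1" for i
      proof -
        have "\<epsilon> i ^ 2 = (x $ i * \<xi> $ i) ^ 2 / (S ^ 2 * (csqrt (x $ i)) ^ 2)"
          by (simp add: \<epsilon>_def power_divide power_mult_distrib)
        then show ?thesis unfolding y power2_csqrt using S False by simp
      qed
      then have \<epsilon>: "\<epsilon> i \<in> {-1, 1}" for i by (auto simp: power2_eq_1_iff)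
      have "1 + (\<Sum>i\<in>UNIV. \<epsilon> i * (\<chi> i. csqrt (x $ i)) $ i) = 1 + (\<Sum>i\<in>UNIV. - (x $ i * \<xi> $ i / S))"
        using r by (simp add: \<epsilon>_def)
      also have "\<dots> = 0" using S by (simp add: sum_negf S_def flip: sum_divide_distrib)
      finally have "1 + (\<Sum>i\<in>UNIV. \<epsilon> i * (\<chi> i. csqrt (x $ i)) $ i) = 0" .
      then have "(\<Prod>\<epsilon>\<in>{\<epsilon>. \<forall>i. \<epsilon> i \<in> {-1, 1}}. 1 + (\<Sum>i\<in>UNIV. \<epsilon> i * (\<chi> i. csqrt (x $ i)) $ i)) = 0"
        using \<epsilon> by (intro prod_zero finite_signs) blast
      then show ?thesis by (simp add: sing_product_def)
    qed
  next
    fix x :: "complex ^ 'm" assume "x \<in> {x. sing_product x (\<chi> i. csqrt (x $ i)) = 0}"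
    then have z: "sing_product x (\<chi> i. csqrt (x $ i)) = 0" by simp
    have "\<exists>\<xi>. (x, \<xi>) \<in> char_variety ?I \<and> (\<exists>i. \<xi> $ i \<noteq> 0)"
    proof (cases "\<exists>i. x $ i = 0")
      case True
      then obtain k where k: "x $ k = 0" by blast
      define \<xi> :: "complex ^ 'm" where "\<xi> = (\<chi> i. if i = k then 1 else 0)"
      have "(x, \<xi>) \<in> char_variety ?I" "\<xi> $ k \<noteq> 0"
        using k by (auto intro!: char_variety_thetas_vanish simp: \<xi>_def)
      then show ?thesis by blast
    next
      case False
      then have x: "x $ i \<noteq> 0" for i by blast
      then have "(\<Prod>\<epsilon>\<in>{\<epsilon>. \<forall>i. \<epsilon> i \<in> {-1, 1}}. 1 + (\<Sum>i\<in>UNIV. \<epsilon> i * (\<chi> i. csqrt (x $ i)) $ i)) = 0"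
        using z by (simp add: sing_product_def)
      then obtain \<epsilon> :: "'m \<Rightarrow> complex"
        where \<epsilon>: "\<And>i. \<epsilon> i \<in> {-1, 1}" "1 + (\<Sum>i\<in>UNIV. \<epsilon> i * csqrt (x $ i)) = 0"
        unfolding prod_zero_iff[OF finite_signs] vec_lambda_beta by blast
      \<comment> \<open>Chosen such that \<open>x\<^sub>i \<xi>\<^sub>i\<close> is the square root of \<open>x\<^sub>i\<close> with the sign \<open>\<epsilon>\<^sub>i\<close> and hence \<open>S = -1\<close>.\<close>
      define \<xi> :: "complex ^ 'm" where "\<xi> = (\<chi> i. \<epsilon> i * csqrt (x $ i) / x $ i)"
      have y: "x $ i * \<xi> $ i = \<epsilon> i * csqrt (x $ i)" for i using x by (simp add: \<xi>_def)
      have S: "(\<Sum>j\<in>UNIV. x $ j * \<xi> $ j) = - 1" unfolding y using \<epsilon>(2) by (simp add: add_eq_0_iff)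
      have "\<epsilon> i ^ 2 = 1" for i using \<epsilon>(1)[of i] by auto
      then have "(x, \<xi>) \<in> char_variety ?I"
        by (intro char_variety_generic x) (simp_all add: S, simp add: y power_mult_distrib)
      moreover have "\<xi> $ i \<noteq> 0" for i
        using x \<epsilon>(1)[of i] by (auto simp: \<xi>_def)
      ultimately show ?thesis by blast
    qed
    then show "x \<in> sing_locus ?I" by (force simp: sing_locus_def)
  qed
qed (rule sing_product_polynomial)

end
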